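(* Let $G$ be a non-abelian group of order $2^6$. Then $\mathrm{Aut}_c(G)=\mathrm{Aut}_z(G)$ if and only if $G$ belongs to one of the isoclinism families $\Phi_{12}$ or $\Phi_{13}$.
   Context: $\mathrm{Aut}_c(G)$ is the group of all class preserving automorphisms of $G$, i.e. automorphisms $\alpha$ such that $\alpha(x)$ is conjugate to $x$ in $G$ for every $x\in G$. $\mathrm{Aut}_z(G)$ is the group of all central automorphisms of $G$, i.e. automorphisms $\phi$ such that $g^{-1}\phi(g)\in Z(G)$ for every $g\in G$. Commutators are $[a,b]=a^{-1}b^{-1}ab$ and $\gamma_2(G)$ is the commutator subgroup. Two groups $G,H$ are isoclinic if there are isomorphisms $\theta:G/Z(G)\to H/Z(H)$ and $\varphi:\gamma_2(G)\to\gamma_2(H)$ such that $\varphi([a,b])=[a',b']$ whenever $a'Z(H)=\theta(aZ(G))$ and $b'Z(H)=\theta(bZ(G))$. The families are those of the Hall–Senior list of groups of order 64; in the presentations below, on generators $\alpha_1,\dots,\alpha_6$, all commutators of pairs of generators not listed (other than inverses of listed ones) are trivial. $\Phi_{12}$ consists of all groups of order 64 isoclinic to the group of order 64 with defining relations $$\alpha_1^2=1,\ \alpha_2^2=\alpha_1,\ \alpha_3^2=\alpha_1,\ \alpha_4^2=1,\ \alpha_5^2=\alpha_3,\ \alpha_6^2=\alpha_4,\ [\alpha_4,\alpha_5]=\alpha_1,\ [\alpha_3,\alpha_6]=\alpha_1,\ [\alpha_5,\alpha_6]=\alpha_2.$$ $\Phi_{13}$ consists of all groups of order 64 isoclinic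 to the group of order 64 with defining relations $$\alpha_1^2=\alpha_2^2=1,\ \alpha_3^2=\alpha_1,\ \alpha_4^2=\alpha_2,\ \alpha_5^2=\alpha_6^2=1,\ [\alpha_3,\alpha_5]=\alpha_1,\ [\alpha_4,\alpha_5]=\alpha_1\alpha_2,\ [\alpha_3,\alpha_6]=\alpha_1\alpha_2,\ [\alpha_4,\alpha_6]=\alpha_2.$$ *)

theory Defs
  imports "HOL-Algebra.Algebra"
begin

section \<open>Centre, commutators and automorphisms\<close>

definition center :: "('a, 'm) monoid_scheme \<Rightarrow> 'a set" where
  "center G = {z \<in> carrier G. \<forall>g \<in> carrier G. z \<otimes>\<^bsub>G\<^esub> g = g \<otimes>\<^bsub>G\<^esub> z}"

definition commutator :: "('a, 'm) monoid_scheme \<Rightarrow> 'a \<Rightarrow> 'a \<Rightarrow> 'a" where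
  "commutator G a b = inv\<^bsub>G\<^esub> a \<otimes>\<^bsub>G\<^esub> inv\<^bsub>G\<^esub> b \<otimes>\<^bsub>G\<^esub> a \<otimes>\<^bsub>G\<^esub> b"

text \<open>
  The library's \<^const>\<open>derived\<close> is generated by the elements
  \<open>a b a\<inverse> b\<inverse>\<close>; these are the elements \<open>commutator G (a\<inverse>) (b\<inverse>)\<close>, so
  the two commutator conventions give the same subgroup.
\<close>

abbreviation commutator_subgroup :: "('a, 'm) monoid_scheme \<Rightarrow> 'a set" where
  "commutator_subgroup G \<equiv> derived G (carrier G)"

definition class_preserving_auts :: "('a, 'm) monoid_scheme \<Rightarrow> ('a \<Rightarrow> 'a) set" where
  "class_preserving_auts G =
     {\<alpha> \<in> auto G. \<forall>x \<in> carrier G. \<exists>g \<in> carrier G. \<alpha> x = inv\<^bsub>G\<^esub> g \<otimes>\<^bsub>G\<^esub> x \<otimes>\<^bsub>G\<^esub> g}"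

definition central_auts :: "('a, 'm) monoid_scheme \<Rightarrow> ('a \<Rightarrow> 'a) set" where
  "central_auts G = {\<phi> \<in> auto G. \<forall>g \<in> carrier G. inv\<^bsub>G\<^esub> g \<otimes>\<^bsub>G\<^esub> \<phi> g \<in> center G}"


section \<open>Isoclinism\<close>

definition isoclinic :: "('a, 'm) monoid_scheme \<Rightarrow> ('b, 'n) monoid_scheme \<Rightarrow> bool" where
  "isoclinic G H \<longleftrightarrow>
     (\<exists>\<theta> \<in> iso (G Mod center G) (H Mod center H).
      \<exists>\<phi> \<in> iso (G\<lparr>carrier := commutator_subgroup G\<rparr>) (H\<lparr>carrier := commutator_subgroup H\<rparr>).
        \<forall>a \<in> carrier G. \<forall>b \<in> carrier G. \<forall>a' \<in> carrier H. \<forall>b' \<in> carrier H.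
          center H #>\<^bsub>H\<^esub> a' = \<theta> (center G #>\<^bsub>G\<^esub> a) \<longrightarrow>
          center H #>\<^bsub>H\<^esub> b' = \<theta> (center G #>\<^bsub>G\<^esub> b) \<longrightarrow>
          \<phi> (commutator G a b) = commutator H a' b')"


section \<open>Groups given by generators and relations\<close>

text \<open>
  Elements of the group presented by generators of type \<open>'g\<close> and a set \<open>R\<close> of relations
  \<open>(s, t)\<close>, read \<open>s = t\<close>, are the classes of formal group expressions in the generators modulo the
  least congruence containing \<open>R\<close> and the group laws.
\<close>

datatype 'g gterm =
    Gen 'g
  | One
  | Inv "'g gterm"
  | Mul "'g gterm" "'g gterm"  (infixl \<open>\<star>\<close> 70)

definition Comm :: "'g gterm \<Rightarrow> 'g gterm \<Rightarrow> 'g gterm" where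
  "Comm s t = Inv s \<star> Inv t \<star> s \<star> t"

inductive pres_eq :: "('g gterm \<times> 'g gterm) set \<Rightarrow> 'g gterm \<Rightarrow> 'g gterm \<Rightarrow> bool" for R where
  rel: "(s, t) \<in> R \<Longrightarrow> pres_eq R s t"
| refl: "pres_eq R s s"
| sym: "pres_eq R s t \<Longrightarrow> pres_eq R t s"
| trans: "pres_eq R s t \<Longrightarrow> pres_eq R t u \<Longrightarrow> pres_eq R s u"
| mul_cong: "pres_eq R s s' \<Longrightarrow> pres_eq R t t' \<Longrightarrow> pres_eq R (s \<star> t) (s' \<star> t')"
| inv_cong: "pres_eq R s s' \<Longrightarrow> pres_eq R (Inv s) (Inv s')"
| assoc: "pres_eq R (s \<star> t \<star> u) (s \<star> (t \<star> u))"
| left_one: "pres_eq R (One \<star> s) s"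
| left_inv: "pres_eq R (Inv s \<star> s) One"

definition pres_rel :: "('g gterm \<times> 'g gterm) set \<Rightarrow> ('g gterm \<times> 'g gterm) set" where
  "pres_rel R = {(s, t). pres_eq R s t}"

definition presented_group :: "('g gterm \<times> 'g gterm) set \<Rightarrow> 'g gterm set monoid" where
  "presented_group R =
     \<lparr>carrier = UNIV // pres_rel R,
      monoid.mult = \<lambda>A B. \<Union>s\<in>A. \<Union>t\<in>B. pres_rel R `` {s \<star> t},
      monoid.one = pres_rel R `` {One}\<rparr>"

lemma equiv_pres_rel: "equiv UNIV (pres_rel R)"
  unfolding pres_rel_def
  by (rule equivI) (auto simp: refl_on_def sym_def trans_def intro: pres_eq.intros(2-4))

lemma pres_class_eq_iff: "pres_rel R `` {s} = pres_rel R `` {t} \<longleftrightarrow> pres_eq R s t"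
  using eq_equiv_class_iff[OF equiv_pres_rel, of s t R] by (simp add: pres_rel_def)

lemma presented_group_mult:
  "pres_rel R `` {s} \<otimes>\<^bsub>presented_group R\<^esub> pres_rel R `` {t} = pres_rel R `` {s \<star> t}"
proof -
  have "congruent2 (pres_rel R) (pres_rel R) (\<lambda>s t. pres_rel R `` {s \<star> t})"
    unfolding congruent2_def
    by (auto simp: pres_class_eq_iff) (auto simp: pres_rel_def intro: pres_eq.mul_cong)
  from UN_equiv_class2[OF equiv_pres_rel equiv_pres_rel this UNIV_I UNIV_I]
  show ?thesis by (simp add: presented_group_def)
qed

lemma presented_group_carrier:
  "carrier (presented_group R) = range (\<lambda>s. pres_rel R `` {s})"
  by (auto simp: presented_group_def quotient_def)

lemma presented_group_one: "\<one>\<^bsub>presented_group R\<^esub> = pres_rel R `` {One}"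
  by (simp add: presented_group_def)

lemma group_presented_group: "group (presented_group R)"
proof (rule groupI)
  fix x assume "x \<in> carrier (presented_group R)"
  then obtain s where x: "x = pres_rel R `` {s}" by (auto simp: presented_group_carrier)
  have "pres_rel R `` {Inv s} \<otimes>\<^bsub>presented_group R\<^esub> x = \<one>\<^bsub>presented_group R\<^esub>"
    by (simp add: x presented_group_mult presented_group_one pres_class_eq_iff pres_eq.left_inv)
  then show "\<exists>y\<in>carrier (presented_group R). y \<otimes>\<^bsub>presented_group R\<^esub> x = \<one>\<^bsub>presented_group R\<^esub>"
    by (auto simp: presented_group_carrier)
next
  fix x y z
  assume "x \<in> carrier (presented_group R)" "y \<in> carrier (presented_group R)"
    "z \<in> carrier (presented_group R)"
  then obtain s t u where "x = pres_rel R `` {s}" "y = pres_rel R `` {t}" "z = pres_rel R `` {u}"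
    by (auto simp: presented_group_carrier)
  then show "x \<otimes>\<^bsub>presented_group R\<^esub> y \<otimes>\<^bsub>presented_group R\<^esub> z =
      x \<otimes>\<^bsub>presented_group R\<^esub> (y \<otimes>\<^bsub>presented_group R\<^esub> z)"
    by (simp only: presented_group_mult pres_class_eq_iff pres_eq.assoc)
next
  fix x assume "x \<in> carrier (presented_group R)"
  then obtain s where "x = pres_rel R `` {s}" by (auto simp: presented_group_carrier)
  then show "\<one>\<^bsub>presented_group R\<^esub> \<otimes>\<^bsub>presented_group R\<^esub> x = x"
    by (simp only: presented_group_one presented_group_mult pres_class_eq_iff pres_eq.left_one)
qed (auto simp: presented_group_carrier presented_group_mult presented_group_one)


section \<open>The families \<open>\<Phi>\<^sub>1\<^sub>2\<close> and \<open>\<Phi>\<^sub>1\<^sub>3\<close>\<close>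

datatype gen6 = A1 | A2 | A3 | A4 | A5 | A6

text \<open>
  Every unordered pair of generators outside \<open>L\<close> commutes; the case \<open>i = j\<close>
  adds only relations that hold in every group.
\<close>

definition trivial_comms :: "gen6 set set \<Rightarrow> (gen6 gterm \<times> gen6 gterm) set" where
  "trivial_comms L = {(Comm (Gen i) (Gen j), One) | i j. {i, j} \<notin> L}"

definition Phi12_rels :: "(gen6 gterm \<times> gen6 gterm) set" where
  "Phi12_rels =
     {(Gen A1 \<star> Gen A1, One),
      (Gen A2 \<star> Gen A2, Gen A1),
      (Gen A3 \<star> Gen A3, Gen A1),
      (Gen A4 \<star> Gen A4, One),
      (Gen A5 \<star> Gen A5, Gen A3),
      (Gen A6 \<star> Gen A6, Gen A4),
      (Comm (Gen A4) (Gen A5), Gen A1),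
      (Comm (Gen A3) (Gen A6), Gen A1),
      (Comm (Gen A5) (Gen A6), Gen A2)}
     \<union> trivial_comms {{A4, A5}, {A3, A6}, {A5, A6}}"

definition Phi13_rels :: "(gen6 gterm \<times> gen6 gterm) set" where
  "Phi13_rels =
     {(Gen A1 \<star> Gen A1, One),
      (Gen A2 \<star> Gen A2, One),
      (Gen A3 \<star> Gen A3, Gen A1),
      (Gen A4 \<star> Gen A4, Gen A2),
      (Gen A5 \<star> Gen A5, One),
      (Gen A6 \<star> Gen A6, One),
      (Comm (Gen A3) (Gen A5), Gen A1),
      (Comm (Gen A4) (Gen A5), Gen A1 \<star> Gen A2),
      (Comm (Gen A3) (Gen A6), Gen A1 \<star> Gen A2),
      (Comm (Gen A4) (Gen A6), Gen A2)}
     \<union> trivial_comms {{A3, A5}, {A4, A5}, {A3, A6}, {A4, A6}}"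

definition in_Phi12 :: "('a, 'm) monoid_scheme \<Rightarrow> bool" where
  "in_Phi12 G \<longleftrightarrow> group G \<and> order G = 64 \<and> isoclinic G (presented_group Phi12_rels)"

definition in_Phi13 :: "('a, 'm) monoid_scheme \<Rightarrow> bool" where
  "in_Phi13 G \<longleftrightarrow> group G \<and> order G = 64 \<and> isoclinic G (presented_group Phi13_rels)"

end

theory Submission
  imports Defs
begin

text \<open>
  Inner automorphisms preserve classes, so \<open>Aut\<^sub>c(G) = Aut\<^sub>z(G)\<close> forces nilpotency class two, and
  a homomorphism \<open>f : G \<rightarrow> Z(G)\<close> for which \<open>x \<mapsto> x f(x)\<close> is injective must satisfy
  \<open>f(x) \<in> [x, G]\<close> for all \<open>x\<close>. If some commutator \<open>[a, b]\<close> has order \<open>n > 2\<close>, then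
  \<open>n\<^sup>2 |Z(G)| \<le> 64\<close> and \<open>n \<le> |Z(G)|\<close> give \<open>n = |Z(G)| = 4\<close>, and \<open>G\<close> is generated by \<open>a\<close>, \<open>b\<close> and
  \<open>Z(G)\<close>; this is \<open>\<Phi>\<^sub>1\<^sub>2\<close>. Otherwise \<open>G/Z(G)\<close> is elementary abelian, and suitable homomorphisms
  \<open>f\<close> show that \<open>Z(G)\<close> is elementary abelian and \<open>[x, G] = Z(G)\<close> for every non-central \<open>x\<close>. Counting
  leaves \<open>|Z(G)| = 4\<close>, where commuting is transitive on non-central elements, and a basis of
  \<open>G/Z(G)\<close> adapted to two of its classes exhibits the commutator map of \<open>\<Phi>\<^sub>1\<^sub>3\<close>.

  Conversely, in both families \<open>Z(G) = \<gamma>\<^sub>2(G)\<close>, so a central automorphism induces a homomorphism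
  \<open>G/Z(G) \<rightarrow> \<gamma>\<^sub>2(G)\<close>, and for every such \<open>f\<close> and \<open>x\<close> the value \<open>f(x)\<close> is a commutator \<open>[x, y]\<close>.
\<close>

section \<open>Commutators and the centre\<close>

text \<open>Both families are identified through an explicit bilinear form, so neither the order nor
  a normal form of the presented groups is computed: a permutation model only has to show that a few
  central elements do not collapse. Both forms are 2 by 2 determinants. \<open>pairing12\<close> is
  the one over Z/4. \<open>pairing13\<close> is the one over the field with four elements 0, 1, w, w
  + 1, written over F_2 with a = (1,0), b = (w,0), c = (0,1), d = (0,w), p = 1 and q = w; hence
  [b, d] = w^2 = 1 + w becomes p q. In the hard direction the hypothesis can be exploited only by
  producing homomorphisms into the centre. They are built from cyclic quotients by subgroups maximal
  among those avoiding a given element, which replaces a decomposition of abelian groups. The order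
  64 excludes a centre of order 2 by parity: G/Z(G) would be a nondegenerate alternating space of
  dimension 5 over F_2.\<close>

context group
begin

lemma cancel_inv [simp]:
  assumes "x \<in> carrier G" "y \<in> carrier G"
  shows "x \<otimes> (inv x \<otimes> y) = y" "inv x \<otimes> (x \<otimes> y) = y"
  using assms by (simp_all flip: m_assoc)

lemma commuting_inv:
  assumes "x \<in> carrier G" "y \<in> carrier G" "x \<otimes> y = y \<otimes> x"
  shows "inv x \<otimes> y = y \<otimes> inv x"
proof -
  have "inv x \<otimes> y = inv x \<otimes> (y \<otimes> x) \<otimes> inv x"
    using assms(1,2) by (simp add: m_assoc)
  then show ?thesis
    unfolding assms(3)[symmetric] using assms(1,2) by (simp flip: m_assoc)
qed

lemma centerD:
  assumes "z \<in> center G"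
  shows "z \<in> carrier G" and "g \<in> carrier G \<Longrightarrow> z \<otimes> g = g \<otimes> z"
  using assms by (auto simp: center_def)

lemma center_subgroup: "subgroup (center G) G"
proof (rule subgroupI)
  show "center G \<subseteq> carrier G" "center G \<noteq> {}"
    by (auto simp: center_def)
next
  fix a assume a: "a \<in> center G"
  have "inv a \<otimes> g = g \<otimes> inv a" if g: "g \<in> carrier G" for g
    using commuting_inv[OF centerD(1)[OF a] g centerD(2)[OF a g]] .
  then show "inv a \<in> center G"
    using centerD(1)[OF a] by (auto simp: center_def)
next
  fix a b assume a: "a \<in> center G" and b: "b \<in> center G"
  have "a \<otimes> b \<otimes> g = g \<otimes> (a \<otimes> b)" if g: "g \<in> carrier G" for g
    using centerD(2)[OF a g] centerD(2)[OF b g] centerD(1)[OF a] centerD(1)[OF b] g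
    by (metis m_assoc)
  then show "a \<otimes> b \<in> center G"
    using centerD(1)[OF a] centerD(1)[OF b] by (auto simp: center_def)
qed

lemmas center_mult_closed = subgroup.m_closed[OF center_subgroup]
  and center_inv_closed = subgroup.m_inv_closed[OF center_subgroup]
  and center_one_closed = subgroup.one_closed[OF center_subgroup]

lemma center_normal: "center G \<lhd> G"
proof (rule normal_invI[OF center_subgroup])
  fix x h assume "x \<in> carrier G" "h \<in> center G"
  then show "x \<otimes> h \<otimes> inv x \<in> center G"
    by (metis centerD inv_closed r_inv r_one m_assoc)
qed

lemma commutator_closed [simp, intro]:
  "\<lbrakk>x \<in> carrier G; y \<in> carrier G\<rbrakk> \<Longrightarrow> commutator G x y \<in> carrier G"
  by (simp add: commutator_def)

lemma mult_commutator:
  "\<lbrakk>x \<in> carrier G; y \<in> carrier G\<rbrakk> \<Longrightarrow> x \<otimes> commutator G x y = inv y \<otimes> x \<otimes> y"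
  by (simp add: commutator_def m_assoc)

text \<open>Removes the inverses from a commutator relation; both algebraic identities and concrete
  permutation models are checked in this form.\<close>

lemma commutator_eq_iff:
  assumes "x \<in> carrier G" "y \<in> carrier G" "z \<in> carrier G"
  shows "commutator G x y = z \<longleftrightarrow> x \<otimes> y = y \<otimes> x \<otimes> z"
proof -
  have "y \<otimes> x \<otimes> commutator G x y = x \<otimes> y"
    using assms by (simp add: commutator_def m_assoc)
  moreover have "y \<otimes> x \<otimes> commutator G x y = y \<otimes> x \<otimes> z \<longleftrightarrow> commutator G x y = z"
    using assms l_cancel[of "y \<otimes> x" "commutator G x y" z] by auto
  ultimately show ?thesis by metis
qed

lemma swap_commutator:
  "\<lbrakk>x \<in> carrier G; y \<in> carrier G\<rbrakk> \<Longrightarrow> x \<otimes> y = y \<otimes> x \<otimes> commutator G x y"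
  using commutator_eq_iff[of x y "commutator G x y"] by simp

lemma commutator_eq_one_iff:
  assumes "x \<in> carrier G" "y \<in> carrier G"
  shows "commutator G x y = \<one> \<longleftrightarrow> x \<otimes> y = y \<otimes> x"
  using commutator_eq_iff[OF assms one_closed] assms by simp

lemma commutator_self [simp]: "x \<in> carrier G \<Longrightarrow> commutator G x x = \<one>"
  by (simp add: commutator_eq_one_iff)

lemma commutator_swap:
  "\<lbrakk>x \<in> carrier G; y \<in> carrier G\<rbrakk> \<Longrightarrow> commutator G y x = inv (commutator G x y)"
  by (simp add: commutator_def inv_mult_group m_assoc)

lemma commutator_center:
  assumes "z \<in> center G" "x \<in> carrier G"
  shows "commutator G z x = \<one>" "commutator G x z = \<one>"
  using assms centerD[OF assms(1)] by (auto simp: commutator_eq_one_iff)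

lemma center_iff_commutator:
  "z \<in> center G \<longleftrightarrow> z \<in> carrier G \<and> (\<forall>x\<in>carrier G. commutator G z x = \<one>)"
  by (auto simp: center_def commutator_eq_one_iff)

lemma commutator_in_derived:
  assumes "x \<in> carrier G" "y \<in> carrier G"
  shows "commutator G x y \<in> commutator_subgroup G"
proof -
  have "commutator G x y = inv x \<otimes> inv y \<otimes> inv (inv x) \<otimes> inv (inv y)"
    using assms by (simp add: commutator_def)
  then show ?thesis
    unfolding derived_def using assms inv_closed by (intro generate.incl) blast
qed

lemma derived_minimal:
  assumes "subgroup E G" "\<And>x y. \<lbrakk>x \<in> carrier G; y \<in> carrier G\<rbrakk> \<Longrightarrow> commutator G x y \<in> E"
  shows "commutator_subgroup G \<subseteq> E"
  unfolding derived_def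
proof (rule generate_subgroup_incl[OF _ assms(1)], safe)
  fix x y assume xy: "x \<in> carrier G" "y \<in> carrier G"
  then have "x \<otimes> y \<otimes> inv x \<otimes> inv y = commutator G (inv x) (inv y)"
    by (simp add: commutator_def)
  then show "x \<otimes> y \<otimes> inv x \<otimes> inv y \<in> E"
    using assms(2)[of "inv x" "inv y"] xy by simp
qed

lemma derived_subgroup_carrier: "subgroup (commutator_subgroup G) G"
  by (intro derived_is_subgroup) simp

text \<open>Supplies normality of subgroups that are chosen only by maximality: they contain all
  commutators by construction.\<close>

lemma normal_if_commutators:
  assumes "subgroup N G" "\<And>x y. \<lbrakk>x \<in> carrier G; y \<in> carrier G\<rbrakk> \<Longrightarrow> commutator G x y \<in> N"
  shows "N \<lhd> G"
proof (rule normal_invI[OF assms(1)])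
  fix x h assume x: "x \<in> carrier G" and h: "h \<in> N"
  then have hG: "h \<in> carrier G" using subgroup.mem_carrier[OF assms(1)] by blast
  have "x \<otimes> h \<otimes> inv x = h \<otimes> commutator G h (inv x)"
    using x hG by (simp add: mult_commutator)
  then show "x \<otimes> h \<otimes> inv x \<in> N"
    using assms x h hG by (simp add: subgroup.m_closed)
qed

text \<open>Only [x, z] has to move past \<open>y\<close>, so centrality is asked of this one
  commutator. The identity can therefore be used before class two is known.\<close>

lemma commutator_mult_left_in_center:
  assumes "x \<in> carrier G" "y \<in> carrier G" "z \<in> carrier G" "commutator G x z \<in> center G"
  shows "commutator G (x \<otimes> y) z = commutator G x z \<otimes> commutator G y z"
proof -
  have "z \<otimes> (x \<otimes> y) \<otimes> (commutator G x z \<otimes> commutator G y z)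
      = z \<otimes> x \<otimes> (y \<otimes> commutator G x z) \<otimes> commutator G y z"
    using assms by (simp add: m_assoc)
  also have "y \<otimes> commutator G x z = commutator G x z \<otimes> y"
    using centerD(2)[OF assms(4,2)] by simp
  also have "z \<otimes> x \<otimes> (commutator G x z \<otimes> y) \<otimes> commutator G y z
      = (z \<otimes> x \<otimes> commutator G x z) \<otimes> y \<otimes> commutator G y z"
    using assms by (simp add: m_assoc)
  also have "z \<otimes> x \<otimes> commutator G x z = x \<otimes> z"
    using assms swap_commutator[of x z] by simp
  also have "x \<otimes> z \<otimes> y \<otimes> commutator G y z = x \<otimes> (z \<otimes> y \<otimes> commutator G y z)"
    using assms by (simp add: m_assoc)
  also have "z \<otimes> y \<otimes> commutator G y z = y \<otimes> z"
    using assms swap_commutator[of y z] by simp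
  finally show ?thesis
    using assms by (simp add: commutator_eq_iff m_assoc)
qed

lemma hom_eq_on_generate:
  assumes "group H" "f \<in> hom G H" "g \<in> hom G H" "S \<subseteq> carrier G"
    and "\<And>s. s \<in> S \<Longrightarrow> f s = g s" "x \<in> generate G S"
  shows "f x = g x"
  using assms(6)
proof (induction rule: generate.induct)
  case one
  show ?case using assms by (metis hom_one is_group)
next
  case (incl h)
  then show ?case using assms by simp
next
  case (inv h)
  interpret f: group_hom G H f using assms by (simp add: group_hom_def group_hom_axioms_def is_group)
  interpret g: group_hom G H g using assms by (simp add: group_hom_def group_hom_axioms_def is_group)
  show ?case using inv assms by auto
next
  case (eng h1 h2)
  then have "h1 \<in> carrier G" "h2 \<in> carrier G"
    using generate_in_carrier[OF assms(4)] by auto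
  then show ?case using eng assms by (simp add: hom_mult)
qed

text \<open>As \<open>E\<close> is central, the elements \<open>u\<close> with [u, s] in
  \<open>E\<close> form a subgroup for each fixed \<open>s\<close>. This extends the assumption from
  generators to the whole group in one argument, and after swapping in the other.\<close>

lemma commutators_in:
  assumes E: "subgroup E G" "E \<subseteq> center G" and S: "S \<subseteq> carrier G" "generate G S = carrier G"
    and st: "\<forall>s\<in>S. \<forall>t\<in>S. commutator G s t \<in> E"
    and x: "x \<in> carrier G" and y: "y \<in> carrier G"
  shows "commutator G x y \<in> E"
proof -
  have sub: "subgroup {u \<in> carrier G. commutator G u s \<in> E} G" if s: "s \<in> carrier G" for s
  proof (rule subgroupI)
    show "{u \<in> carrier G. commutator G u s \<in> E} \<noteq> {}"
      using s subgroup.one_closed[OF E(1)]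
      by (auto intro!: exI[of _ \<one>] simp: commutator_center center_one_closed)
  next
    fix a assume "a \<in> {u \<in> carrier G. commutator G u s \<in> E}"
    then have a: "a \<in> carrier G" "commutator G a s \<in> E" by auto
    have "\<one> = commutator G (a \<otimes> inv a) s"
      using a s by (simp add: commutator_center center_one_closed)
    also have "\<dots> = commutator G a s \<otimes> commutator G (inv a) s"
      using a s E by (intro commutator_mult_left_in_center) auto
    finally have "commutator G (inv a) s = inv (commutator G a s)"
      using a s inv_equality[of "commutator G (inv a) s" "commutator G a s"] inv_comm
      by (metis commutator_closed inv_closed)
    then show "inv a \<in> {u \<in> carrier G. commutator G u s \<in> E}"
      using a subgroup.m_inv_closed[OF E(1)] by simp
  next
    fix a b assume "a \<in> {u \<in> carrier G. commutator G u s \<in> E}" "b \<in> {u \<in> carrier G. commutator G u s \<in> E}"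
    then show "a \<otimes> b \<in> {u \<in> carrier G. commutator G u s \<in> E}"
      using s E subgroup.m_closed[OF E(1)] by (auto simp: commutator_mult_left_in_center subset_iff)
  qed auto
  have swap: "commutator G u v \<in> E" if "commutator G v u \<in> E" "u \<in> carrier G" "v \<in> carrier G" for u v
    using that subgroup.m_inv_closed[OF E(1)] by (metis commutator_swap)
  have "commutator G u s \<in> E" if "s \<in> S" "u \<in> carrier G" for u s
    using generate_subgroup_incl[OF _ sub[of s], of S] that S st by blast
  then have "S \<subseteq> {u \<in> carrier G. commutator G u x \<in> E}"
    using S x swap by blast
  then have "carrier G \<subseteq> {u \<in> carrier G. commutator G u x \<in> E}"
    using generate_subgroup_incl[OF _ sub[OF x], of S] S(2) by simp
  then show ?thesis using x y swap by blast
qed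

lemma center_if_commutes_generators:
  assumes S: "S \<subseteq> carrier G" "generate G S = carrier G" and z: "z \<in> carrier G"
    and comm: "\<And>s. s \<in> S \<Longrightarrow> commutator G z s = \<one>"
  shows "z \<in> center G"
proof -
  have "subgroup {u \<in> carrier G. u \<otimes> z = z \<otimes> u} G"
  proof (rule subgroupI)
    fix a assume "a \<in> {u \<in> carrier G. u \<otimes> z = z \<otimes> u}"
    then show "inv a \<in> {u \<in> carrier G. u \<otimes> z = z \<otimes> u}"
      using z commuting_inv[of a z] by auto
  qed (use z in \<open>auto simp: m_assoc\<close>, metis m_assoc)
  moreover have "s \<otimes> z = z \<otimes> s" if "s \<in> S" for s
    using comm[OF that] that S(1) z commutator_eq_one_iff[of z s] by auto
  ultimately have "carrier G \<subseteq> {u \<in> carrier G. u \<otimes> z = z \<otimes> u}"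
    using generate_subgroup_incl[of S "{u \<in> carrier G. u \<otimes> z = z \<otimes> u}"] S by blast
  then have "g \<otimes> z = z \<otimes> g" if "g \<in> carrier G" for g
    using subsetD[OF _ that, of "{u \<in> carrier G. u \<otimes> z = z \<otimes> u}"] by simp
  then have "\<forall>g\<in>carrier G. z \<otimes> g = g \<otimes> z"
    by metis
  then show ?thesis using z unfolding center_def by simp
qed

end

locale class_two_group = group G for G (structure) +
  assumes commutator_central: "\<lbrakk>x \<in> carrier G; y \<in> carrier G\<rbrakk> \<Longrightarrow> commutator G x y \<in> center G"
begin

lemma commutator_hom_left:
  "y \<in> carrier G \<Longrightarrow> (\<lambda>x. commutator G x y) \<in> hom G G"
  by (auto simp: hom_def commutator_mult_left_in_center commutator_central)

lemma commutator_hom_right: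
  assumes "x \<in> carrier G" shows "(\<lambda>y. commutator G x y) \<in> hom G G"
proof -
  have "commutator G x (y \<otimes> z) = commutator G x y \<otimes> commutator G x z"
    if "y \<in> carrier G" "z \<in> carrier G" for y z
  proof -
    have "commutator G x (y \<otimes> z) = inv (commutator G y x \<otimes> commutator G z x)"
      using that assms by (simp add: commutator_swap[of "y \<otimes> z"] commutator_mult_left_in_center commutator_central)
    also have "\<dots> = commutator G x z \<otimes> commutator G x y"
      using that assms by (simp add: inv_mult_group flip: commutator_swap)
    also have "\<dots> = commutator G x y \<otimes> commutator G x z"
      using that assms by (intro centerD(2)[OF commutator_central]) auto
    finally show ?thesis .
  qed
  then show ?thesis using assms by (auto simp: hom_def)
qed

lemmas commutator_mult_left = hom_mult[OF commutator_hom_left]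
  and commutator_mult_right = hom_mult[OF commutator_hom_right]

lemma derived_subset_center: "commutator_subgroup G \<subseteq> center G"
  by (intro derived_minimal center_subgroup commutator_central)

end

section \<open>Commutator pairings and isoclinism\<close>

text \<open>
  An isoclinism class of groups is encoded by the pairing \<open>G/Z(G) \<times> G/Z(G) \<rightarrow> \<gamma>\<^sub>2(G)\<close>
  induced by the commutator map, transported to fixed groups \<open>Q \<cong> G/Z(G)\<close> and \<open>D \<cong> \<gamma>\<^sub>2(G)\<close>.
\<close>

definition commutator_pairing ::
  "('a, 'm) monoid_scheme \<Rightarrow> ('q, 'n) monoid_scheme \<Rightarrow> ('d, 'k) monoid_scheme \<Rightarrow> ('q \<Rightarrow> 'q \<Rightarrow> 'd) \<Rightarrow> bool"
  where "commutator_pairing G Q D \<omega> \<longleftrightarrow>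
    (\<forall>x\<in>carrier Q. \<forall>y\<in>carrier Q. \<omega> x y \<in> carrier D) \<and>
    (\<exists>\<pi> \<epsilon>. \<pi> \<in> hom G Q \<and> \<pi> ` carrier G = carrier Q \<and> kernel G Q \<pi> = center G \<and>
      \<epsilon> \<in> iso D (G\<lparr>carrier := commutator_subgroup G\<rparr>) \<and>
      (\<forall>x\<in>carrier G. \<forall>y\<in>carrier G. commutator G x y = \<epsilon> (\<omega> (\<pi> x) (\<pi> y))))"

lemma central_quotient_iso:
  assumes "group G" "group Q" "\<pi> \<in> hom G Q" "\<pi> ` carrier G = carrier Q" "kernel G Q \<pi> = center G"
  shows "(\<lambda>Y. the_elem (\<pi> ` Y)) \<in> iso (G Mod center G) Q"
    and "x \<in> carrier G \<Longrightarrow> the_elem (\<pi> ` (center G #>\<^bsub>G\<^esub> x)) = \<pi> x"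
proof -
  interpret group_hom G Q \<pi>
    using assms by (simp add: group_hom_def group_hom_axioms_def)
  show "(\<lambda>Y. the_elem (\<pi> ` Y)) \<in> iso (G Mod center G) Q"
    using FactGroup_iso_set assms by metis
  assume x: "x \<in> carrier G"
  have "\<pi> ` (center G #>\<^bsub>G\<^esub> x) = {\<pi> x}"
  proof -
    have "\<pi> (z \<otimes>\<^bsub>G\<^esub> x) = \<pi> x" if "z \<in> center G" for z
      using that x by (auto simp: kernel_def simp flip: assms(5))
    moreover have "\<one>\<^bsub>G\<^esub> \<in> center G"
      using G.center_one_closed by simp
    ultimately show ?thesis
      by (auto simp: r_coset_def image_iff)
  qed
  then show "the_elem (\<pi> ` (center G #>\<^bsub>G\<^esub> x)) = \<pi> x" by simp
qed

text \<open>The two isomorphisms are detours through the fixed groups: G/Z(G) to \<open>Q\<close> to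
  H/Z(H), and \<gamma>_2(G) to \<open>D\<close> to \<gamma>_2(H). They are compatible because
  corresponding cosets have the same image in \<open>Q\<close>.\<close>

lemma isoclinic_if_same_pairing:
  fixes G :: "('a, 'm) monoid_scheme" and H :: "('b, 'n) monoid_scheme"
  assumes G: "group G" and H: "group H" and Q: "group Q" and D: "group D"
    and "commutator_pairing G Q D \<omega>" "commutator_pairing H Q D \<omega>"
  shows "isoclinic G H"
proof -
  obtain \<pi> \<epsilon> where \<pi>: "\<pi> \<in> hom G Q" "\<pi> ` carrier G = carrier Q" "kernel G Q \<pi> = center G"
    and \<epsilon>: "\<epsilon> \<in> iso D (G\<lparr>carrier := commutator_subgroup G\<rparr>)"
    and \<pi>\<epsilon>: "\<And>x y. \<lbrakk>x \<in> carrier G; y \<in> carrier G\<rbrakk> \<Longrightarrow> commutator G x y = \<epsilon> (\<omega> (\<pi> x) (\<pi> y))"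
    using assms(5) unfolding commutator_pairing_def by blast
  obtain \<pi>' \<epsilon>' where \<pi>': "\<pi>' \<in> hom H Q" "\<pi>' ` carrier H = carrier Q" "kernel H Q \<pi>' = center H"
    and \<epsilon>': "\<epsilon>' \<in> iso D (H\<lparr>carrier := commutator_subgroup H\<rparr>)"
    and \<pi>\<epsilon>': "\<And>x y. \<lbrakk>x \<in> carrier H; y \<in> carrier H\<rbrakk> \<Longrightarrow> commutator H x y = \<epsilon>' (\<omega> (\<pi>' x) (\<pi>' y))"
    using assms(6) unfolding commutator_pairing_def by blast
  have \<omega>: "\<omega> x y \<in> carrier D" if "x \<in> carrier Q" "y \<in> carrier Q" for x y
    using assms(5) that unfolding commutator_pairing_def by blast
  define P where "P Y = the_elem (\<pi> ` Y)" for Y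
  define P' where "P' Y = the_elem (\<pi>' ` Y)" for Y
  have P: "P \<in> iso (G Mod center G) Q" "\<And>x. x \<in> carrier G \<Longrightarrow> P (center G #>\<^bsub>G\<^esub> x) = \<pi> x"
    using central_quotient_iso[OF G Q \<pi>] by (simp_all add: P_def[abs_def])
  have P': "P' \<in> iso (H Mod center H) Q" "\<And>x. x \<in> carrier H \<Longrightarrow> P' (center H #>\<^bsub>H\<^esub> x) = \<pi>' x"
    using central_quotient_iso[OF H Q \<pi>'] by (simp_all add: P'_def[abs_def])
  have HZ: "group (H Mod center H)"
    using H normal.factorgroup_is_group[OF group.center_normal] by blast
  define \<theta> where "\<theta> = inv_into (carrier (H Mod center H)) P' \<circ> P"
  define \<phi> where "\<phi> = \<epsilon>' \<circ> inv_into (carrier D) \<epsilon>"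
  have \<theta>: "\<theta> \<in> iso (G Mod center G) (H Mod center H)"
    using iso_set_trans[OF P(1) group.iso_set_sym[OF HZ P'(1)]] by (simp add: \<theta>_def)
  have \<phi>: "\<phi> \<in> iso (G\<lparr>carrier := commutator_subgroup G\<rparr>) (H\<lparr>carrier := commutator_subgroup H\<rparr>)"
    using iso_set_trans[OF group.iso_set_sym[OF D \<epsilon>] \<epsilon>'] by (simp add: \<phi>_def)
  have \<theta>_eq: "\<pi>' x' = \<pi> x"
    if "x \<in> carrier G" "x' \<in> carrier H" "center H #>\<^bsub>H\<^esub> x' = \<theta> (center G #>\<^bsub>G\<^esub> x)" for x x'
  proof -
    have "P' ` carrier (H Mod center H) = carrier Q"
      using P'(1) by (simp add: iso_def bij_betw_def)
    moreover have "\<pi> x \<in> carrier Q"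
      using that \<pi> by blast
    ultimately have "P' (\<theta> (center G #>\<^bsub>G\<^esub> x)) = \<pi> x"
      using that by (simp add: \<theta>_def P(2) f_inv_into_f)
    then show ?thesis
      using that P'(2) by metis
  qed
  have "\<phi> (commutator G a b) = commutator H a' b'"
    if "a \<in> carrier G" "b \<in> carrier G" "a' \<in> carrier H" "b' \<in> carrier H"
      "center H #>\<^bsub>H\<^esub> a' = \<theta> (center G #>\<^bsub>G\<^esub> a)" "center H #>\<^bsub>H\<^esub> b' = \<theta> (center G #>\<^bsub>G\<^esub> b)" for a b a' b'
  proof -
    have "inj_on \<epsilon> (carrier D)"
      using \<epsilon> by (simp add: iso_def bij_betw_def)
    moreover have "\<omega> (\<pi> a) (\<pi> b) \<in> carrier D"
      using that \<pi>(2) \<omega> by blast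
    ultimately show ?thesis
      using that by (simp add: \<phi>_def \<pi>\<epsilon> \<pi>\<epsilon>' \<theta>_eq)
  qed
  then show ?thesis
    unfolding isoclinic_def using \<theta> \<phi> by blast
qed

text \<open>The data for \<open>H\<close> are pulled back along the isoclinism. A commutator of
  \<open>G\<close> is compared with one of \<open>H\<close> by choosing representatives of the image
  cosets, and injectivity of \<open>\<phi>\<close> then brings the identity back to
  \<open>G\<close>.\<close>

lemma commutator_pairing_isoclinic:
  fixes G :: "('a, 'm) monoid_scheme" and H :: "('b, 'n) monoid_scheme"
  assumes G: "group G" and H: "group H" and Q: "group Q"
    and "isoclinic G H" "commutator_pairing H Q D \<omega>"
  shows "commutator_pairing G Q D \<omega>"
proof -
  obtain \<pi>' \<epsilon>' where \<pi>': "\<pi>' \<in> hom H Q" "\<pi>' ` carrier H = carrier Q" "kernel H Q \<pi>' = center H"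
    and \<epsilon>': "\<epsilon>' \<in> iso D (H\<lparr>carrier := commutator_subgroup H\<rparr>)"
    and \<pi>\<epsilon>': "\<And>x y. \<lbrakk>x \<in> carrier H; y \<in> carrier H\<rbrakk> \<Longrightarrow> commutator H x y = \<epsilon>' (\<omega> (\<pi>' x) (\<pi>' y))"
    and \<omega>: "\<forall>x\<in>carrier Q. \<forall>y\<in>carrier Q. \<omega> x y \<in> carrier D"
    using assms(5) unfolding commutator_pairing_def by blast
  obtain \<theta> \<phi> where \<theta>: "\<theta> \<in> iso (G Mod center G) (H Mod center H)"
    and \<phi>: "\<phi> \<in> iso (G\<lparr>carrier := commutator_subgroup G\<rparr>) (H\<lparr>carrier := commutator_subgroup H\<rparr>)"
    and \<theta>\<phi>: "\<And>a b a' b'. \<lbrakk>a \<in> carrier G; b \<in> carrier G; a' \<in> carrier H; b' \<in> carrier H;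
      center H #>\<^bsub>H\<^esub> a' = \<theta> (center G #>\<^bsub>G\<^esub> a); center H #>\<^bsub>H\<^esub> b' = \<theta> (center G #>\<^bsub>G\<^esub> b)\<rbrakk>
      \<Longrightarrow> \<phi> (commutator G a b) = commutator H a' b'"
    using assms(4) unfolding isoclinic_def by blast
  interpret ZG: normal "center G" G
    by (rule group.center_normal[OF G])
  define P' where "P' Y = the_elem (\<pi>' ` Y)" for Y
  have P': "P' \<in> iso (H Mod center H) Q" "\<And>x. x \<in> carrier H \<Longrightarrow> P' (center H #>\<^bsub>H\<^esub> x) = \<pi>' x"
    using central_quotient_iso[OF H Q \<pi>'] by (simp_all add: P'_def[abs_def])
  have iso: "P' \<circ> \<theta> \<in> iso (G Mod center G) Q"
    by (rule iso_set_trans[OF \<theta> P'(1)])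
  define \<pi> where "\<pi> x = P' (\<theta> (center G #>\<^bsub>G\<^esub> x))" for x
  define \<epsilon> where "\<epsilon> = inv_into (commutator_subgroup G) \<phi> \<circ> \<epsilon>'"
  have coset: "center G #>\<^bsub>G\<^esub> x \<in> carrier (G Mod center G)" if "x \<in> carrier G" for x
    using that by (auto simp: carrier_FactGroup)
  have \<pi>: "\<pi> \<in> hom G Q"
    using Group.hom_compose[OF ZG.r_coset_hom_Mod, of "P' \<circ> \<theta>" Q] iso
    by (auto simp: iso_def \<pi>_def[abs_def] comp_def)
  have surj: "\<pi> ` carrier G = carrier Q"
  proof -
    have "carrier Q = (P' \<circ> \<theta>) ` carrier (G Mod center G)"
      using iso by (simp add: iso_def bij_betw_def)
    then show ?thesis by (simp add: carrier_FactGroup image_image \<pi>_def)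
  qed
  have one: "(P' \<circ> \<theta>) (center G) = \<one>\<^bsub>Q\<^esub>"
    using iso hom_one[of "P' \<circ> \<theta>" "G Mod center G" Q] ZG.factorgroup_is_group Q
    by (simp add: iso_def)
  have "\<pi> x = \<one>\<^bsub>Q\<^esub> \<longleftrightarrow> x \<in> center G" if x: "x \<in> carrier G" for x
  proof -
    have "inj_on (P' \<circ> \<theta>) (carrier (G Mod center G))"
      using iso by (simp add: iso_def bij_betw_def)
    moreover have "center G \<in> carrier (G Mod center G)"
      using ZG.factorgroup_is_group group.is_monoid monoid.one_closed one_FactGroup by metis
    ultimately have "\<pi> x = \<one>\<^bsub>Q\<^esub> \<longleftrightarrow> center G #>\<^bsub>G\<^esub> x = center G"
      using one coset[OF x] by (auto simp: \<pi>_def inj_on_def)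
    then show ?thesis
      using ZG.rcos_const[OF G] group.rcos_self[OF G x ZG.is_subgroup] x by blast
  qed
  then have ker: "kernel G Q \<pi> = center G"
    using ZG.subset by (auto simp: kernel_def)
  have "group (G\<lparr>carrier := commutator_subgroup G\<rparr>)"
    using G group.derived_subgroup_carrier group.subgroup_imp_group by blast
  from group.iso_set_sym[OF this \<phi>] have \<epsilon>: "\<epsilon> \<in> iso D (G\<lparr>carrier := commutator_subgroup G\<rparr>)"
    using iso_set_trans[OF \<epsilon>'] by (simp add: \<epsilon>_def)
  have "commutator G a b = \<epsilon> (\<omega> (\<pi> a) (\<pi> b))" if ab: "a \<in> carrier G" "b \<in> carrier G" for a b
  proof -
    have "\<exists>x'\<in>carrier H. center H #>\<^bsub>H\<^esub> x' = \<theta> (center G #>\<^bsub>G\<^esub> x)" if "x \<in> carrier G" for x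
    proof -
      have "\<theta> (center G #>\<^bsub>G\<^esub> x) \<in> carrier (H Mod center H)"
        using \<theta> coset[OF that] by (auto simp: iso_def hom_def)
      then show ?thesis by (auto simp: carrier_FactGroup)
    qed
    then obtain a' b' where a'b': "a' \<in> carrier H" "b' \<in> carrier H"
      "center H #>\<^bsub>H\<^esub> a' = \<theta> (center G #>\<^bsub>G\<^esub> a)" "center H #>\<^bsub>H\<^esub> b' = \<theta> (center G #>\<^bsub>G\<^esub> b)"
      using ab by meson
    then have "\<pi> a = \<pi>' a'" "\<pi> b = \<pi>' b'"
      using P'(2) by (metis \<pi>_def)+
    then have "\<phi> (commutator G a b) = \<epsilon>' (\<omega> (\<pi> a) (\<pi> b))"
      using \<theta>\<phi>[OF ab a'b'] a'b' by (simp add: \<pi>\<epsilon>')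
    moreover have "inj_on \<phi> (commutator_subgroup G)"
      using \<phi> by (simp add: iso_def bij_betw_def)
    ultimately show ?thesis
      using group.commutator_in_derived[OF G ab] by (simp add: \<epsilon>_def inv_into_f_f flip: \<open>\<phi> _ = _\<close>)
  qed
  then show ?thesis
    unfolding commutator_pairing_def using \<pi> surj ker \<epsilon> \<omega> by blast
qed

text \<open>Both sides of the commutator formula are homomorphisms in each variable, so agreement on
  generators suffices. Nondegeneracy then identifies the kernel of \<open>\<pi>\<close> with the
  centre, and the image of \<open>\<epsilon>\<close> is a subgroup containing all commutators, hence
  all of \<gamma>_2(G).\<close>

lemma (in class_two_group) commutator_pairingI:
  assumes Q: "group Q" and D: "group D" and \<pi>: "\<pi> \<in> hom G Q" "\<pi> ` carrier G = carrier Q"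
    and \<epsilon>: "\<epsilon> \<in> hom D G" "inj_on \<epsilon> (carrier D)" "\<epsilon> ` carrier D \<subseteq> commutator_subgroup G"
    and \<omega>l: "\<And>y. y \<in> carrier Q \<Longrightarrow> (\<lambda>x. \<omega> x y) \<in> hom Q D"
    and \<omega>r: "\<And>x. x \<in> carrier Q \<Longrightarrow> \<omega> x \<in> hom Q D"
    and nondeg: "\<And>x. \<lbrakk>x \<in> carrier Q; \<And>y. y \<in> carrier Q \<Longrightarrow> \<omega> x y = \<one>\<^bsub>D\<^esub>\<rbrakk> \<Longrightarrow> x = \<one>\<^bsub>Q\<^esub>"
    and S: "S \<subseteq> carrier G" "generate G S = carrier G"
    and st: "\<And>s t. \<lbrakk>s \<in> S; t \<in> S\<rbrakk> \<Longrightarrow> commutator G s t = \<epsilon> (\<omega> (\<pi> s) (\<pi> t))"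
  shows "commutator_pairing G Q D \<omega>"
proof -
  have \<pi>Q: "\<pi> x \<in> carrier Q" if "x \<in> carrier G" for x
    using that \<pi> by blast
  have homl: "(\<lambda>x. \<epsilon> (\<omega> (\<pi> x) (\<pi> y))) \<in> hom G G" if "y \<in> carrier G" for y
    using Group.hom_compose[OF Group.hom_compose[OF \<pi>(1) \<omega>l[OF \<pi>Q[OF that]]] \<epsilon>(1)] by (simp add: comp_def)
  have homr: "(\<lambda>y. \<epsilon> (\<omega> (\<pi> x) (\<pi> y))) \<in> hom G G" if "x \<in> carrier G" for x
    using Group.hom_compose[OF Group.hom_compose[OF \<pi>(1) \<omega>r[OF \<pi>Q[OF that]]] \<epsilon>(1)] by (simp add: comp_def)
  have step: "commutator G s y = \<epsilon> (\<omega> (\<pi> s) (\<pi> y))" if "s \<in> S" "y \<in> carrier G" for s y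
  proof -
    have s: "s \<in> carrier G" using that S by blast
    show ?thesis
      using hom_eq_on_generate[OF is_group commutator_hom_right[OF s] homr[OF s] S(1)] st that S(2) by simp
  qed
  have comm: "commutator G x y = \<epsilon> (\<omega> (\<pi> x) (\<pi> y))" if "x \<in> carrier G" "y \<in> carrier G" for x y
    using hom_eq_on_generate[OF is_group commutator_hom_left[OF that(2)] homl[OF that(2)] S(1)] step that S(2) by simp
  have \<omega>D: "\<omega> x y \<in> carrier D" if "x \<in> carrier Q" "y \<in> carrier Q" for x y
    using \<omega>r[OF that(1)] that(2) by (auto simp: hom_def)
  have one: "\<epsilon> \<one>\<^bsub>D\<^esub> = \<one>"
    using \<epsilon>(1) D by (simp add: hom_one is_group)
  interpret D: group D by (rule D)
  interpret Q: group Q by (rule Q)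
  have "\<pi> x = \<one>\<^bsub>Q\<^esub> \<longleftrightarrow> x \<in> center G" if x: "x \<in> carrier G" for x
  proof
    assume "\<pi> x = \<one>\<^bsub>Q\<^esub>"
    moreover have "\<omega> \<one>\<^bsub>Q\<^esub> (\<pi> y) = \<one>\<^bsub>D\<^esub>" if "y \<in> carrier G" for y
      using hom_one[OF \<omega>l[OF \<pi>Q[OF that]] Q D] .
    ultimately show "x \<in> center G"
      using x by (simp add: center_iff_commutator comm one)
  next
    assume z: "x \<in> center G"
    show "\<pi> x = \<one>\<^bsub>Q\<^esub>"
    proof (rule nondeg)
      fix q assume q: "q \<in> carrier Q"
      then obtain y where y: "y \<in> carrier G" "q = \<pi> y" using \<pi> by blast
      have "\<epsilon> (\<omega> (\<pi> x) q) = \<epsilon> \<one>\<^bsub>D\<^esub>"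
        using commutator_center(1)[OF z y(1)] comm[OF x y(1)] y one by simp
      then show "\<omega> (\<pi> x) q = \<one>\<^bsub>D\<^esub>"
        using \<epsilon>(2) \<omega>D[OF \<pi>Q[OF x] q] by (simp add: inj_on_def)
    qed (use x \<pi>Q in blast)
  qed
  then have ker: "kernel G Q \<pi> = center G"
    using centerD(1) by (auto simp: kernel_def)
  have "subgroup (\<epsilon> ` carrier D) G"
    using \<epsilon>(1) D group_hom.img_is_subgroup[of D G \<epsilon>] is_group by (simp add: group_hom_def group_hom_axioms_def)
  then have "commutator_subgroup G \<subseteq> \<epsilon> ` carrier D"
    using comm \<omega>D \<pi>Q by (intro derived_minimal) auto
  then have "\<epsilon> \<in> iso D (G\<lparr>carrier := commutator_subgroup G\<rparr>)"
    using \<epsilon> by (auto simp: iso_def hom_def bij_betw_def)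
  then show ?thesis
    unfolding commutator_pairing_def using \<pi> ker comm \<omega>D by blast
qed

section \<open>The pairings of the two families\<close>

lemma (in group_hom) card_kernel_times_image:
  assumes "finite (carrier G)"
  shows "card (kernel G H h) * card (h ` carrier G) = order G"
proof -
  let ?I = "H\<lparr>carrier := h ` carrier G\<rparr>"
  have "group ?I"
    using img_is_subgroup subgroup.subgroup_is_group[of "h ` carrier G" H] by blast
  then interpret I: group_hom G ?I h
    by (simp add: group_hom_def group_hom_axioms_def) (auto simp: hom_def)
  have "(\<lambda>Y. the_elem (h ` Y)) \<in> iso (G Mod kernel G ?I h) ?I"
    by (rule I.FactGroup_iso_set) simp
  then have "card (carrier (G Mod kernel G ?I h)) = card (h ` carrier G)"
    using bij_betw_same_card by (fastforce simp: iso_def)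
  moreover have "kernel G ?I h = kernel G H h"
    by (simp add: kernel_def)
  ultimately show ?thesis
    using G.lagrange_finite[OF assms, of "kernel G H h"] subgroup_kernel by (simp add: FactGroup_def mult.commute)
qed

context class_two_group
begin

lemma commutator_int_pow_left:
  assumes "x \<in> carrier G" "y \<in> carrier G"
  shows "commutator G (x [^] (k::int)) y = commutator G x y [^] k"
  using hom_int_pow[OF commutator_hom_left[OF assms(2)] assms(1) is_group is_group] .

lemma commutator_int_pow_right:
  assumes "x \<in> carrier G" "y \<in> carrier G"
  shows "commutator G x (y [^] (k::int)) = commutator G x y [^] k"
  using hom_int_pow[OF commutator_hom_right[OF assms(1)] assms(2) is_group is_group] .

lemma commutator_nat_pow_left:
  assumes "x \<in> carrier G" "y \<in> carrier G"
  shows "commutator G (x [^] (k::nat)) y = commutator G x y [^] k"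
  using hom_nat_pow[OF commutator_hom_left[OF assms(2)] assms(1) is_group is_group] .

lemma commutator_nat_pow_right:
  assumes "x \<in> carrier G" "y \<in> carrier G"
  shows "commutator G x (y [^] (k::nat)) = commutator G x y [^] k"
  using hom_nat_pow[OF commutator_hom_right[OF assms(1)] assms(2) is_group is_group] .

text \<open>\<open>lg\<close> is a discrete logarithm with respect to \<open>\<epsilon>\<close>. It
  is meaningful on every commutator, because those of generators lie in the central image of
  \<open>\<epsilon>\<close>. Logarithms of commutators with basis elements will serve as coordinates
  on G/Z(G).\<close>

lemma commutator_log:
  fixes D :: "('d, 'k) monoid_scheme"
  assumes D: "group D" and \<epsilon>: "\<epsilon> \<in> hom D G" "inj_on \<epsilon> (carrier D)" "\<epsilon> ` carrier D \<subseteq> center G"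
    and S: "S \<subseteq> carrier G" "generate G S = carrier G"
    and st: "\<forall>s\<in>S. \<forall>t\<in>S. commutator G s t \<in> \<epsilon> ` carrier D"
  defines "lg \<equiv> inv_into (carrier D) \<epsilon>"
  shows "y \<in> carrier G \<Longrightarrow> (\<lambda>x. lg (commutator G x y)) \<in> hom G D"
    and "x \<in> carrier G \<Longrightarrow> (\<lambda>y. lg (commutator G x y)) \<in> hom G D"
    and "d \<in> carrier D \<Longrightarrow> lg (\<epsilon> d) = d"
    and "lg \<one> = \<one>\<^bsub>D\<^esub>"
proof -
  let ?I = "G\<lparr>carrier := \<epsilon> ` carrier D\<rparr>"
  have sub: "subgroup (\<epsilon> ` carrier D) G"
    using \<epsilon>(1) D group_hom.img_is_subgroup[of D G \<epsilon>] is_group by (simp add: group_hom_def group_hom_axioms_def)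
  have "\<epsilon> \<in> iso D ?I"
    using \<epsilon> by (auto simp: iso_def hom_def bij_betw_def)
  from group.iso_set_sym[OF D this] have log: "lg \<in> hom ?I D"
    by (simp add: iso_def lg_def)
  have comm: "commutator G x y \<in> \<epsilon> ` carrier D" if "x \<in> carrier G" "y \<in> carrier G" for x y
    using commutators_in[OF sub \<epsilon>(3) S st] that by blast
  show "(\<lambda>x. lg (commutator G x y)) \<in> hom G D" if y: "y \<in> carrier G"
  proof -
    have "(\<lambda>x. commutator G x y) \<in> hom G ?I"
      using commutator_hom_left[OF y] comm y by (auto simp: hom_def)
    from Group.hom_compose[OF this log] show ?thesis by (simp add: comp_def)
  qed
  show "(\<lambda>y. lg (commutator G x y)) \<in> hom G D" if x: "x \<in> carrier G"
  proof -
    have "commutator G x \<in> hom G ?I"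
      using commutator_hom_right[OF x] comm x by (auto simp: hom_def)
    from Group.hom_compose[OF this log] show ?thesis by (simp add: comp_def)
  qed
  show log_\<epsilon>: "lg (\<epsilon> d) = d" if "d \<in> carrier D" for d
    using \<epsilon>(2) that by (simp add: lg_def)
  have "\<epsilon> \<one>\<^bsub>D\<^esub> = \<one>"
    using \<epsilon>(1) D by (simp add: hom_one is_group)
  then show "lg \<one> = \<one>\<^bsub>D\<^esub>"
    using log_\<epsilon>[of "\<one>\<^bsub>D\<^esub>"] group.is_monoid[OF D] monoid.one_closed by metis
qed

end

section \<open>The form of the first family: the determinant over Z/4\<close>

abbreviation "D12 \<equiv> integer_mod_group 4"
abbreviation "Q12 \<equiv> D12 \<times>\<times> D12"

definition pairing12 :: "int \<times> int \<Rightarrow> int \<times> int \<Rightarrow> int" where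
  "pairing12 x y = (fst x * snd y - snd x * fst y) mod 4"

lemma carrier_D12: "carrier D12 = {0, 1, 2, 3}"
  by (auto simp: carrier_integer_mod_group)

lemma Q12_group: "comm_group Q12"
proof -
  have "group Q12"
    by (intro DirProd_group) simp_all
  then show ?thesis
    by (rule group.group_comm_groupI) (auto simp: DirProd_def add.commute)
qed

lemma pairing12_hom:
  "(\<lambda>x. pairing12 x y) \<in> hom Q12 D12" "pairing12 x \<in> hom Q12 D12"
proof -
  have "((i + i') mod 4 * l - (j + j') mod 4 * k) mod 4 = ((i * l - j * k) mod 4 + (i' * l - j' * k) mod 4) mod 4"
    for i i' j j' k l :: int
  proof -
    have "((i + i') mod 4 * l - (j + j') mod 4 * k) mod 4 = ((i + i') * l - (j + j') * k) mod 4"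
      by (intro mod_diff_cong mod_mult_left_eq)
    also have "(i + i') * l - (j + j') * k = (i * l - j * k) + (i' * l - j' * k)"
      by (simp add: algebra_simps)
    finally show ?thesis by (simp only: mod_add_eq)
  qed
  note left = this
  have "(i * ((l + l') mod 4) - j * ((k + k') mod 4)) mod 4 = ((i * l - j * k) mod 4 + (i * l' - j * k') mod 4) mod 4"
    for i j k k' l l' :: int
    using left[of l l' i k k' j] by (simp only: mult.commute)
  then show "pairing12 x \<in> hom Q12 D12"
    by (simp add: hom_def pairing12_def DirProd_def carrier_integer_mod_group split_beta)
  show "(\<lambda>x. pairing12 x y) \<in> hom Q12 D12"
    using left by (simp add: hom_def pairing12_def DirProd_def carrier_integer_mod_group split_beta)
qed

lemma pairing12_nondegenerate:
  assumes "x \<in> carrier Q12" "\<And>y. y \<in> carrier Q12 \<Longrightarrow> pairing12 x y = \<one>\<^bsub>D12\<^esub>"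
  shows "x = \<one>\<^bsub>Q12\<^esub>"
proof -
  have "pairing12 x (0, 1) = 0" "pairing12 x (1, 0) = 0"
    using assms(2) by (auto simp: DirProd_def)
  then show ?thesis
    using assms(1) by (auto simp: DirProd_def pairing12_def carrier_D12)
qed

text \<open>The determinant form over Z/4 is unimodular, so a homomorphism is pairing with one
  vector \<open>y\<close>, the same for all arguments.\<close>

lemma pairing12_represents_homs:
  assumes f: "f \<in> hom Q12 D12" and x: "x \<in> carrier Q12"
  shows "\<exists>y\<in>carrier Q12. f x = pairing12 x y"
proof -
  obtain i j where ij: "x = (i, j)" "i \<in> {0, 1, 2, 3}" "j \<in> {0, 1, 2, 3}"
    using x by (auto simp: carrier_D12)
  define r s where "r = f (1, 0)" and "s = f (0, 1)"
  have add: "f ((i + k) mod 4, (j + l) mod 4) = (f (i, j) + f (k, l)) mod 4"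
    if "i \<in> {0..<4}" "j \<in> {0..<4}" "k \<in> {0..<4}" "l \<in> {0..<4}" for i j k l
    using hom_mult[OF f, of "(i, j)" "(k, l)"] that by (simp add: DirProd_def carrier_integer_mod_group)
  have "f \<one>\<^bsub>Q12\<^esub> = \<one>\<^bsub>D12\<^esub>"
    using f Q12_group by (intro hom_one) (auto simp: comm_group_def)
  then have zero: "f (0, 0) = 0" by (simp add: DirProd_def)
  have r: "f (1, 0) = r" "f (2, 0) = 2 * r mod 4" "f (3, 0) = 3 * r mod 4"
    using add[of 1 0 1 0] add[of 2 0 1 0] by (simp_all add: r_def mod_simps)
  have s: "f (0, 1) = s" "f (0, 2) = 2 * s mod 4" "f (0, 3) = 3 * s mod 4"
    using add[of 0 1 0 1] add[of 0 2 0 1] by (simp_all add: s_def mod_simps)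
  have rs: "r \<in> {0..<4}" "s \<in> {0..<4}"
    using f by (auto simp: hom_def r_def s_def carrier_integer_mod_group Pi_iff)
  have "f (i, j) = (f (i, 0) + f (0, j)) mod 4"
    using add[of i 0 0 j] ij by auto
  also have "\<dots> = (i * r + j * s) mod 4"
  proof -
    have "r mod 4 = r" "s mod 4 = s"
      using rs by simp_all
    then have "f (i, 0) = i * r mod 4" "f (0, j) = j * s mod 4"
      using ij(2,3) by (elim insertE emptyE; simp add: r s zero)+
    then show ?thesis by (simp add: mod_add_eq)
  qed
  \<comment> \<open>The witness solves i r + j s = det((i, j), y).\<close>
  also have "\<dots> = pairing12 x ((- s) mod 4, r)"
  proof -
    have "(i * r - j * ((- s) mod 4)) mod 4 = (i * r - j * (- s)) mod 4"
      by (intro mod_diff_cong mod_mult_right_eq HOL.refl)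
    then show ?thesis by (simp add: pairing12_def ij)
  qed
  finally show ?thesis
    using rs ij(1) by (intro bexI[of _ "((- s) mod 4, r)"]) (auto simp: carrier_integer_mod_group)
qed

lemma (in class_two_group) commutator_pairing12I:
  assumes a: "a \<in> carrier G" and b: "b \<in> carrier G" and ord: "ord (commutator G a b) = 4"
    and gen: "generate G ({a, b} \<union> center G) = carrier G"
  shows "commutator_pairing G Q12 D12 pairing12"
proof -
  define c where "c = commutator G a b"
  have c: "c \<in> carrier G" "c \<in> center G" "c \<in> commutator_subgroup G"
    using a b commutator_central commutator_in_derived by (auto simp: c_def)
  define \<epsilon> where "\<epsilon> i = c [^] i" for i :: int
  have pow_eq: "c [^] i = c [^] j \<longleftrightarrow> 4 dvd j - i" for i j :: int
    using int_pow_eq[OF c(1)] ord by (simp add: c_def)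
  have D: "group D12" by simp
  have \<epsilon>_hom: "\<epsilon> \<in> hom D12 G"
  proof -
    have "c [^] ((i + j) mod 4) = c [^] (i + j)" for i j :: int
      by (simp add: pow_eq minus_mod_eq_mult_div)
    then show ?thesis
      using c by (auto simp: hom_def \<epsilon>_def int_pow_mult)
  qed
  have \<epsilon>_inj: "inj_on \<epsilon> (carrier D12)"
    by (auto simp: inj_on_def \<epsilon>_def pow_eq carrier_D12)
  have \<epsilon>_central: "\<epsilon> ` carrier D12 \<subseteq> center G"
    using c center_subgroup by (auto simp: \<epsilon>_def subgroup_int_pow_closed)
  have S: "{a, b} \<union> center G \<subseteq> carrier G"
    using a b centerD(1) by auto
  \<comment> \<open>\<open>3\<close> represents -1 modulo 4, which makes [b, a] visible as a value
    of \<open>\<epsilon>\<close>.\<close>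
  have \<epsilon>s: "\<epsilon> 0 = \<one>" "\<epsilon> 1 = c" "\<epsilon> 3 = inv c"
  proof -
    show "\<epsilon> 3 = inv c"
      using pow_eq[of 3 "-1"] c by (simp add: \<epsilon>_def int_pow_neg)
  qed (use c in \<open>simp_all add: \<epsilon>_def\<close>)
  have ab: "commutator G a b = \<epsilon> 1" "commutator G b a = \<epsilon> 3"
    using \<epsilon>s commutator_swap[OF a b] by (simp_all add: c_def)
  have st: "\<forall>s\<in>{a, b} \<union> center G. \<forall>t\<in>{a, b} \<union> center G. commutator G s t \<in> \<epsilon> ` carrier D12"
  proof (intro ballI)
    fix s t assume that: "s \<in> {a, b} \<union> center G" "t \<in> {a, b} \<union> center G"
    have "commutator G s t \<in> {\<epsilon> 0, \<epsilon> 1, \<epsilon> 3}"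
      using that a b S ab by (auto simp: commutator_center \<epsilon>s(1))
    then show "commutator G s t \<in> \<epsilon> ` carrier D12" by (auto simp: carrier_D12)
  qed
  define lg where "lg = inv_into (carrier D12) \<epsilon>"
  note log = commutator_log[OF D \<epsilon>_hom \<epsilon>_inj \<epsilon>_central S gen st, folded lg_def]
  \<comment> \<open>For x = a^i b^j z with z central, [x, b] = c^i and [a, x] = c^j, so the
    logarithms return the exponents.\<close>
  define \<pi> where "\<pi> x = (lg (commutator G x b), lg (commutator G a x))" for x
  have \<pi>_hom: "\<pi> \<in> hom G Q12"
    using log(1)[OF b] log(2)[OF a] by (auto simp: hom_def \<pi>_def DirProd_def)
  have \<pi>s: "\<pi> a = (1, 0)" "\<pi> b = (0, 1)" "z \<in> center G \<Longrightarrow> \<pi> z = (0, 0)" for z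
    using a b log(3)[of 1] log(4) ab by (simp_all add: \<pi>_def commutator_center)
  have "\<pi> (a [^] i \<otimes> b [^] j) = (i, j)" if "i \<in> carrier D12" "j \<in> carrier D12" for i j
  proof -
    have "commutator G (a [^] i \<otimes> b [^] j) b = \<epsilon> i" "commutator G a (a [^] i \<otimes> b [^] j) = \<epsilon> j"
      using a b c(1) by (simp_all add: commutator_mult_left commutator_mult_right commutator_int_pow_left
          commutator_int_pow_right \<epsilon>_def c_def)
    then show ?thesis using that log(3) by (simp add: \<pi>_def)
  qed
  then have "(i, j) \<in> \<pi> ` carrier G" if "i \<in> carrier D12" "j \<in> carrier D12" for i j
    using that a b by (metis image_eqI int_pow_closed m_closed)
  then have \<pi>_surj: "\<pi> ` carrier G = carrier Q12"
    using \<pi>_hom by (auto simp: hom_def Pi_iff)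
  show ?thesis
  proof (rule commutator_pairingI[OF _ D \<pi>_hom \<pi>_surj \<epsilon>_hom \<epsilon>_inj _ pairing12_hom pairing12_nondegenerate S gen])
    show "group Q12"
      using Q12_group by (simp add: comm_group_def)
    show "\<epsilon> ` carrier D12 \<subseteq> commutator_subgroup G"
      using c derived_subgroup_carrier by (auto simp: \<epsilon>_def subgroup_int_pow_closed)
    fix s t assume "s \<in> {a, b} \<union> center G" "t \<in> {a, b} \<union> center G"
    then show "commutator G s t = \<epsilon> (pairing12 (\<pi> s) (\<pi> t))"
      using a b S by (auto simp: \<pi>s ab commutator_center pairing12_def \<epsilon>s(1))
  qed
qed

section \<open>The form of the second family, in bits so that its properties become
  propositional\<close>

definition xor_group :: "bool monoid" where
  "xor_group = \<lparr>carrier = UNIV, monoid.mult = (\<noteq>), one = False\<rparr>"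

lemma xor_group_simps [simp]:
  "carrier xor_group = UNIV" "x \<otimes>\<^bsub>xor_group\<^esub> y = (x \<noteq> y)" "\<one>\<^bsub>xor_group\<^esub> = False"
  by (simp_all add: xor_group_def)

lemma group_xor_group: "group xor_group"
  by (rule groupI) (auto intro: exI[of _ True])

abbreviation "D13 \<equiv> xor_group \<times>\<times> xor_group"
abbreviation "Q13 \<equiv> D13 \<times>\<times> D13"

lemma D13_group: "group D13"
  by (intro DirProd_group group_xor_group)

lemma Q13_group: "comm_group Q13"
proof -
  have "group Q13"
    by (intro DirProd_group group_xor_group)
  then show ?thesis
    by (rule group.group_comm_groupI) (auto simp: DirProd_def)
qed

text \<open>
  Writing \<open>p = [a, c]\<close> and \<open>q = [a, d]\<close>, the pairing records \<open>[b, c] = q\<close>, \<open>[b, d] = p q\<close> and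
  \<open>[a, b] = [c, d] = 1\<close> with respect to a basis \<open>a, b, c, d\<close> of \<open>G/Z(G)\<close>.
\<close>

fun pairing13 :: "(bool \<times> bool) \<times> (bool \<times> bool) \<Rightarrow> (bool \<times> bool) \<times> (bool \<times> bool) \<Rightarrow> bool \<times> bool" where
  "pairing13 ((i, j), (k, l)) ((i', j'), (k', l')) =
    ((((i \<and> k') \<noteq> (j \<and> l')) \<noteq> ((k \<and> i') \<noteq> (l \<and> j'))),
     ((((i \<and> l') \<noteq> (j \<and> k')) \<noteq> (j \<and> l')) \<noteq> (((l \<and> i') \<noteq> (k \<and> j')) \<noteq> (l \<and> j'))))"

lemma pairing13_hom:
  "(\<lambda>x. pairing13 x y) \<in> hom Q13 D13" "pairing13 x \<in> hom Q13 D13"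
proof -
  \<comment> \<open>An alternating form in characteristic two is symmetric, so additivity in one
    argument gives it in the other.\<close>
  have sym: "pairing13 x y = pairing13 y x" for x y
  proof -
    obtain i j k l i' j' k' l' where "x = ((i, j), (k, l))" "y = ((i', j'), (k', l'))"
      by (metis prod.exhaust)
    then show ?thesis by simp (smt (verit))
  qed
  have add: "pairing13 (x \<otimes>\<^bsub>Q13\<^esub> x') y = pairing13 x y \<otimes>\<^bsub>D13\<^esub> pairing13 x' y" for x x' y
  proof -
    obtain i j k l i' j' k' l' where "x = ((i, j), (k, l))" "x' = ((i', j'), (k', l'))"
      by (metis prod.exhaust)
    moreover obtain a b c d where "y = ((a, b), (c, d))"
      by (metis prod.exhaust)
    ultimately show ?thesis
      by (simp only: mult_DirProd xor_group_simps pairing13.simps prod.inject) (intro conjI; smt (verit))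
  qed
  show left: "(\<lambda>x. pairing13 x y) \<in> hom Q13 D13" for y
    by (intro homI) (simp_all add: add del: mult_DirProd)
  show "pairing13 x \<in> hom Q13 D13"
    using left[of x] by (simp add: sym[of _ x])
qed

lemma pairing13_nondegenerate:
  assumes "x \<in> carrier Q13" "\<And>y. y \<in> carrier Q13 \<Longrightarrow> pairing13 x y = \<one>\<^bsub>D13\<^esub>"
  shows "x = \<one>\<^bsub>Q13\<^esub>"
proof -
  have "pairing13 x y = (False, False)" for y
    using assms(2)[of y] by (simp add: DirProd_def)
  from this[of "((True, False), (False, False))"] this[of "((False, True), (False, False))"]
    this[of "((False, False), (True, False))"] this[of "((False, False), (False, True))"]
  show ?thesis
    by (cases x rule: prod.exhaust) (auto simp: DirProd_def)
qed

text \<open>At the identity a homomorphism vanishes. At any other \<open>x\<close> the map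
  \<open>pairing13 x\<close> takes all four values, as a determinant over a field with a nonzero
  first vector does; unlike over Z/4, the witness \<open>y\<close> is chosen for each
  \<open>x\<close> separately.\<close>

lemma pairing13_represents_homs:
  assumes f: "f \<in> hom Q13 D13" and x: "x \<in> carrier Q13"
  shows "\<exists>y\<in>carrier Q13. f x = pairing13 x y"
proof (cases "x = \<one>\<^bsub>Q13\<^esub>")
  case True
  have "f x = \<one>\<^bsub>D13\<^esub>"
    using f Q13_group D13_group unfolding True by (intro hom_one) (auto simp: comm_group_def)
  then show ?thesis
    using True by (auto simp: DirProd_def intro!: bexI[of _ "((False, False), (False, False))"])
next
  case False
  obtain i j k l u v where x: "x = ((i, j), (k, l))" and fx: "f x = (u, v)"
    by (metis prod.exhaust)
  have "i \<or> j \<or> k \<or> l"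
    using False x by (auto simp: DirProd_def)
  then have "\<exists>i' j' k' l'. pairing13 ((i, j), (k, l)) ((i', j'), (k', l')) = (u, v)"
    by (cases i; cases j; cases k; cases l; cases u; cases v; simp add: ex_bool_eq)
  then obtain y where "pairing13 x y = f x"
    unfolding x fx[unfolded x] by blast
  moreover have "y \<in> carrier Q13"
    by (cases y) (auto simp: DirProd_def)
  ultimately show ?thesis by metis
qed

lemma (in class_two_group) commutator_pairing13I:
  assumes abcd: "a \<in> carrier G" "b \<in> carrier G" "c \<in> carrier G" "d \<in> carrier G"
    and comm: "commutator G a b = \<one>" "commutator G c d = \<one>" "commutator G a c = p" "commutator G a d = q"
      "commutator G b c = q" "commutator G b d = p \<otimes> q"
    and pq: "p \<noteq> \<one>" "q \<noteq> \<one>" "p \<noteq> q" "p \<otimes> p = \<one>" "q \<otimes> q = \<one>"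
    and gen: "generate G ({a, b, c, d} \<union> center G) = carrier G"
  shows "commutator_pairing G Q13 D13 pairing13"
proof -
  have p: "p \<in> carrier G" "p \<in> center G" "p \<in> commutator_subgroup G"
    using abcd commutator_central[of a c] commutator_in_derived[of a c] centerD(1) by (auto simp: comm)
  have q: "q \<in> carrier G" "q \<in> center G" "q \<in> commutator_subgroup G"
    using abcd commutator_central[of a d] commutator_in_derived[of a d] centerD(1) by (auto simp: comm)
  have pq_comm: "q \<otimes> p = p \<otimes> q"
    using centerD(2)[OF p(2) q(1)] by simp
  have canc: "p \<otimes> (p \<otimes> x) = x" "q \<otimes> (q \<otimes> x) = x" "q \<otimes> (p \<otimes> x) = p \<otimes> (q \<otimes> x)" if "x \<in> carrier G" for x
    using that p q pq by (simp_all add: pq_comm flip: m_assoc)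
  define \<epsilon> where "\<epsilon> = (\<lambda>(u, v). (if u then p else \<one>) \<otimes> (if v then q else \<one>))"
  have \<epsilon>s: "\<epsilon> (False, False) = \<one>" "\<epsilon> (True, False) = p" "\<epsilon> (False, True) = q" "\<epsilon> (True, True) = p \<otimes> q"
    using p q by (simp_all add: \<epsilon>_def)
  have \<epsilon>_hom: "\<epsilon> \<in> hom D13 G"
    using p q pq canc pq_comm by (auto simp: hom_def \<epsilon>_def DirProd_def m_assoc)
  have p_neq: "p \<otimes> q \<noteq> \<one>" "p \<otimes> q \<noteq> p" "p \<otimes> q \<noteq> q"
  proof -
    show "p \<otimes> q \<noteq> \<one>"
      using pq p q by (metis l_cancel)
    show "p \<otimes> q \<noteq> p" "p \<otimes> q \<noteq> q"
      using pq p q by auto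
  qed
  have \<epsilon>_inj: "inj_on \<epsilon> (carrier D13)"
    using pq p_neq p_neq[symmetric] by (auto simp: inj_on_def \<epsilon>s all_bool_eq)
  have \<epsilon>_in: "\<epsilon> ` carrier D13 \<subseteq> E" if "subgroup E G" "p \<in> E" "q \<in> E" for E
    using that by (auto simp: \<epsilon>_def subgroup.m_closed subgroup.one_closed)
  have \<epsilon>_central: "\<epsilon> ` carrier D13 \<subseteq> center G"
    by (rule \<epsilon>_in[OF center_subgroup p(2) q(2)])
  let ?S = "{a, b, c, d} \<union> center G"
  have S: "?S \<subseteq> carrier G"
    using abcd centerD(1) by auto
  have inv_pq: "inv p = p" "inv q = q" "inv (p \<otimes> q) = p \<otimes> q"
  proof -
    show "inv p = p" "inv q = q"
      using pq p q by (auto intro: inv_equality)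
    then show "inv (p \<otimes> q) = p \<otimes> q"
      using p q pq_comm by (simp add: inv_mult_group)
  qed
  have comm': "commutator G b a = \<one>" "commutator G d c = \<one>" "commutator G c a = p" "commutator G d a = q"
      "commutator G c b = q" "commutator G d b = p \<otimes> q"
    using abcd commutator_swap[of a b] commutator_swap[of c d] commutator_swap[of a c] commutator_swap[of a d]
      commutator_swap[of b c] commutator_swap[of b d] by (simp_all add: comm inv_pq)
  note comms = comm comm' commutator_self[OF abcd(1)] commutator_self[OF abcd(2)]
    commutator_self[OF abcd(3)] commutator_self[OF abcd(4)] commutator_center
  have st: "\<forall>s\<in>?S. \<forall>t\<in>?S. commutator G s t \<in> \<epsilon> ` carrier D13"
  proof (intro ballI)
    fix s t assume that: "s \<in> ?S" "t \<in> ?S"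
    have "commutator G s t \<in> {\<epsilon> (False, False), \<epsilon> (True, False), \<epsilon> (False, True), \<epsilon> (True, True)}"
      unfolding \<epsilon>s using that S by (auto simp: comms)
    then show "commutator G s t \<in> \<epsilon> ` carrier D13" by auto
  qed
  define lg where "lg = inv_into (carrier D13) \<epsilon>"
  note log = commutator_log[OF D13_group \<epsilon>_hom \<epsilon>_inj \<epsilon>_central S gen st, folded lg_def]
  have logs: "lg \<one> = (False, False)" "lg p = (True, False)" "lg q = (False, True)" "lg (p \<otimes> q) = (True, True)"
    using log(3)[of "(False, False)"] log(3)[of "(True, False)"] log(3)[of "(False, True)"]
      log(3)[of "(True, True)"] by (simp_all add: \<epsilon>s)
  \<comment> \<open>\<open>fst\<close> reads the exponent of \<open>p\<close>. For x = a^i b^j c^k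
    d^l z with z central it is i in [x, c] = p^i q^j and j in [x, d] = q^i (p q)^j; likewise [a, x]
    gives k and [b, x] gives l.\<close>
  define \<pi> where "\<pi> x = ((fst (lg (commutator G x c)), fst (lg (commutator G x d))),
    (fst (lg (commutator G a x)), fst (lg (commutator G b x))))" for x
  have fst_hom: "fst \<in> hom D13 xor_group"
    by (auto simp: hom_def DirProd_def)
  have \<pi>_hom: "\<pi> \<in> hom G Q13"
    using Group.hom_compose[OF log(1)[OF abcd(3)] fst_hom] Group.hom_compose[OF log(1)[OF abcd(4)] fst_hom]
      Group.hom_compose[OF log(2)[OF abcd(1)] fst_hom] Group.hom_compose[OF log(2)[OF abcd(2)] fst_hom]
    by (auto simp: hom_def \<pi>_def DirProd_def)
  have \<pi>s: "\<pi> a = ((True, False), (False, False))" "\<pi> b = ((False, True), (False, False))"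
    "\<pi> c = ((False, False), (True, False))" "\<pi> d = ((False, False), (False, True))"
    "z \<in> center G \<Longrightarrow> \<pi> z = ((False, False), (False, False))" for z
    using abcd by (simp_all add: \<pi>_def comms logs)
  have "((i, j), (k, l)) \<in> \<pi> ` carrier G" for i j k l
  proof -
    let ?x = "(if i then a else \<one>) \<otimes> (if j then b else \<one>) \<otimes> (if k then c else \<one>) \<otimes> (if l then d else \<one>)"
    have "\<pi> ?x = ((i, j), (k, l))"
      using abcd \<pi>s(5)[OF center_one_closed] by (simp add: hom_mult[OF \<pi>_hom] \<pi>s DirProd_def if_distrib[of \<pi>])
    moreover have "?x \<in> carrier G" using abcd by simp
    ultimately show ?thesis by (metis image_eqI)
  qed
  then have \<pi>_surj: "\<pi> ` carrier G = carrier Q13" by auto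
  show ?thesis
  proof (rule commutator_pairingI[OF _ D13_group \<pi>_hom \<pi>_surj \<epsilon>_hom \<epsilon>_inj _ pairing13_hom pairing13_nondegenerate S gen])
    show "group Q13"
      using Q13_group by (simp add: comm_group_def)
    show "\<epsilon> ` carrier D13 \<subseteq> commutator_subgroup G"
      by (rule \<epsilon>_in[OF derived_subgroup_carrier p(3) q(3)])
    fix s t assume "s \<in> ?S" "t \<in> ?S"
    then show "commutator G s t = \<epsilon> (pairing13 (\<pi> s) (\<pi> t))"
      using S by (auto simp: \<pi>s comms \<epsilon>s)
  qed
qed

section \<open>The presented groups\<close>

primrec term_eval :: "('a, 'm) monoid_scheme \<Rightarrow> ('g \<Rightarrow> 'a) \<Rightarrow> 'g gterm \<Rightarrow> 'a" where
  "term_eval K v (Gen g) = v g"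
| "term_eval K v One = \<one>\<^bsub>K\<^esub>"
| "term_eval K v (Inv s) = inv\<^bsub>K\<^esub> (term_eval K v s)"
| "term_eval K v (s \<star> t) = term_eval K v s \<otimes>\<^bsub>K\<^esub> term_eval K v t"

context group
begin

lemma term_eval_closed: "(\<And>g. v g \<in> carrier G) \<Longrightarrow> term_eval G v s \<in> carrier G"
  by (induction s) auto

lemma term_eval_Comm: "term_eval G v (Comm s t) = commutator G (term_eval G v s) (term_eval G v t)"
  by (simp add: Comm_def commutator_def)

text \<open>Used in contrapositive form: a group satisfying the relations separates any two terms
  that it evaluates differently.\<close>

lemma pres_eq_sound:
  assumes "pres_eq R s t" and v: "\<And>g. v g \<in> carrier G"
    and "\<And>s t. (s, t) \<in> R \<Longrightarrow> term_eval G v s = term_eval G v t"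
  shows "term_eval G v s = term_eval G v t"
  using assms(1)
  by (induction rule: pres_eq.induct) (simp_all add: assms(3) term_eval_closed[OF v] m_assoc)

lemma generate_eq_carrier_mono:
  assumes "generate G S = carrier G" "S \<subseteq> generate G T" "T \<subseteq> carrier G"
  shows "generate G T = carrier G"
  using generate_subgroup_incl[OF assms(2) generate_is_subgroup[OF assms(3)]] assms generate_incl by blast

lemma class_two_groupI:
  assumes S: "S \<subseteq> carrier G" "generate G (S \<union> center G) = carrier G"
    and st: "\<And>s t. \<lbrakk>s \<in> S; t \<in> S\<rbrakk> \<Longrightarrow> commutator G s t \<in> center G"
  shows "class_two_group G"
proof (intro class_two_group.intro class_two_group_axioms.intro is_group)
  fix x y assume "x \<in> carrier G" "y \<in> carrier G"
  moreover have "S \<union> center G \<subseteq> carrier G"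
    using S centerD(1) by blast
  moreover have "\<forall>s\<in>S \<union> center G. \<forall>t\<in>S \<union> center G. commutator G s t \<in> center G"
    using st S by (auto simp: commutator_center center_one_closed centerD(1) subset_iff)
  ultimately show "commutator G x y \<in> center G"
    using commutators_in[OF center_subgroup, of "S \<union> center G"] S by blast
qed

lemma ord_eq_4I:
  assumes "x \<in> carrier G" "x \<otimes> x \<noteq> \<one>" "(x \<otimes> x) \<otimes> (x \<otimes> x) = \<one>"
  shows "ord x = 4"
proof -
  have 2: "x [^] (2::nat) = x \<otimes> x"
    using assms(1) by (simp add: numeral_2_eq_2)
  have "x [^] (4::nat) = x [^] (2::nat) \<otimes> x [^] (2::nat)"
    using assms(1) by (simp add: nat_pow_mult)
  then have "ord x dvd 4" "\<not> ord x dvd 2"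
    using assms 2 by (simp_all flip: pow_eq_id)
  moreover have "n = 4" if n: "n dvd 4" "\<not> n dvd 2" for n :: nat
  proof -
    have "n \<le> 4" using n(1) by (simp add: dvd_imp_le)
    then have "n \<in> {0, 1, 2, 3, 4}" by auto
    then show ?thesis using n by auto
  qed
  ultimately show ?thesis by blast
qed

end

text \<open>Permutations as models make associativity and inverses automatic, so that each defining
  relation is a finite check on bit vectors.\<close>

definition permutations :: "('x \<Rightarrow> 'x) monoid" where
  "permutations = \<lparr>carrier = {f. bij f}, monoid.mult = (\<circ>), one = id\<rparr>"

lemma permutations_simps [simp]:
  "carrier permutations = {f. bij f}" "f \<otimes>\<^bsub>permutations\<^esub> g = f \<circ> g" "\<one>\<^bsub>permutations\<^esub> = id"
  by (simp_all add: permutations_def)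

lemma group_permutations: "group permutations"
proof (rule groupI)
  fix f :: "'x \<Rightarrow> 'x" assume "f \<in> carrier permutations"
  then show "\<exists>g\<in>carrier permutations. g \<otimes>\<^bsub>permutations\<^esub> f = \<one>\<^bsub>permutations\<^esub>"
    using bij_imp_bij_inv by (force simp: bij_is_inj)
qed (auto simp: bij_comp comp_assoc)

lemma permutations_commutator_eq:
  assumes "bij f" "bij g" "bij h"
  shows "commutator permutations f g = h \<longleftrightarrow> f \<circ> g = g \<circ> f \<circ> h"
  using group.commutator_eq_iff[OF group_permutations, of f g h] assms by simp

abbreviation pgen :: "('g gterm \<times> 'g gterm) set \<Rightarrow> 'g \<Rightarrow> 'g gterm set" where
  "pgen R g \<equiv> pres_rel R `` {Gen g}"

lemma presented_group_closed [simp]: "pres_rel R `` {s} \<in> carrier (presented_group R)"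
  by (simp add: presented_group_carrier)

lemma presented_group_inv: "inv\<^bsub>presented_group R\<^esub> (pres_rel R `` {s}) = pres_rel R `` {Inv s}"
  by (rule group.inv_equality[OF group_presented_group])
    (simp_all add: presented_group_mult presented_group_one pres_class_eq_iff pres_eq.left_inv)

lemma presented_group_commutator:
  "commutator (presented_group R) (pres_rel R `` {s}) (pres_rel R `` {t}) = pres_rel R `` {Comm s t}"
  by (simp add: commutator_def Comm_def presented_group_inv presented_group_mult)

lemma presented_group_rel:
  "(s, t) \<in> R \<Longrightarrow> pres_rel R `` {s} = pres_rel R `` {t}"
  by (simp add: pres_class_eq_iff pres_eq.rel)

lemma presented_group_generate:
  "generate (presented_group R) (range (pgen R)) = carrier (presented_group R)"
proof
  interpret group "presented_group R" by (rule group_presented_group)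
  show sub: "generate (presented_group R) (range (pgen R)) \<subseteq> carrier (presented_group R)"
    by (rule generate_incl) auto
  have "pres_rel R `` {s} \<in> generate (presented_group R) (range (pgen R))" for s
  proof (induction s)
    case (Gen x)
    then show ?case by (intro generate.incl) simp
  next
    case One
    then show ?case using generate.one[of "presented_group R"] by (simp add: presented_group_one)
  next
    case (Inv s)
    moreover have "range (pgen R) \<subseteq> carrier (presented_group R)" by auto
    ultimately show ?case
      using generate_m_inv_closed[of "range (pgen R)"] by (simp flip: presented_group_inv)
  next
    case (Mul s t)
    then show ?case by (simp add: generate.eng flip: presented_group_mult)
  qed
  then show "carrier (presented_group R) \<subseteq> generate (presented_group R) (range (pgen R))"
    by (auto simp: presented_group_carrier)
qed

lemma trivial_comms_sound:
  assumes "(s, t) \<in> trivial_comms L" and v: "\<And>g. bij (v g)"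
    and comm: "\<And>i j. {i, j} \<notin> L \<Longrightarrow> v i \<circ> v j = v j \<circ> v i"
  shows "term_eval permutations v s = term_eval permutations v t"
proof -
  obtain i j where ij: "s = Comm (Gen i) (Gen j)" "t = One" "{i, j} \<notin> L"
    using assms(1) by (auto simp: trivial_comms_def)
  have "commutator permutations (v i) (v j) = id"
    unfolding permutations_commutator_eq[OF v v bij_id] comp_id by (rule comm[OF ij(3)])
  then show ?thesis
    by (simp add: ij group.term_eval_Comm[OF group_permutations])
qed

text \<open>
  A faithful action on \<open>\<int>/8 \<times> \<int>/4\<close>, written in binary: \<open>\<alpha>\<^sub>2\<close>, \<open>\<alpha>\<^sub>5\<close> and \<open>\<alpha>\<^sub>6\<close> are
  \<open>(t, m) \<mapsto> (t + 2, m)\<close>, \<open>(t + 1 + 2m, m)\<close> and \<open>(t, m + 1)\<close>.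
\<close>

type_synonym bits5 = "bool \<times> bool \<times> bool \<times> bool \<times> bool"

definition act12_c :: "bits5 \<Rightarrow> bits5" where
  "act12_c = (\<lambda>(t2, t1, t0, m1, m0). (t2 \<noteq> t1, \<not> t1, t0, m1, m0))"

text \<open>A binary adder for the increment 1 + 2m modulo 8. The middle bit receives
  \<open>t1\<close>, the carry \<open>t0\<close> and \<open>m0\<close>; the carry into the top bit
  is the majority of these three.\<close>

definition act12_a :: "bits5 \<Rightarrow> bits5" where
  "act12_a = (\<lambda>(t2, t1, t0, m1, m0).
    (((t2 \<noteq> (t1 \<and> t0)) \<noteq> m1) \<noteq> ((t1 \<noteq> t0) \<and> m0), (t1 \<noteq> t0) \<noteq> m0, \<not> t0, m1, m0))"

definition act12_b :: "bits5 \<Rightarrow> bits5" where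
  "act12_b = (\<lambda>(t2, t1, t0, m1, m0). (t2, t1, t0, m1 \<noteq> m0, \<not> m0))"

primrec act12 :: "gen6 \<Rightarrow> bits5 \<Rightarrow> bits5" where
  "act12 A1 = act12_c \<circ> act12_c"
| "act12 A2 = act12_c"
| "act12 A3 = act12_a \<circ> act12_a"
| "act12 A4 = act12_b \<circ> act12_b"
| "act12 A5 = act12_a"
| "act12 A6 = act12_b"

lemma bij_act12: "bij (act12 g)"
proof -
  \<comment> \<open>A map with a power equal to the identity is bijective, so no inverse has to be
    written down.\<close>
  have "act12_a ^^ 8 = id" "act12_b ^^ 4 = id" "act12_c ^^ 4 = id"
    by (simp_all add: fun_eq_iff numeral_eq_Suc act12_a_def act12_b_def act12_c_def all_bool_eq)
  then have "bij act12_a" "bij act12_b" "bij act12_c"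
    by (metis Suc_numeral funpow_Suc_right funpow.simps(2) o_bij semiring_norm(2,5,8) eval_nat_numeral(3))+
  then show ?thesis
    by (cases g) (simp_all add: bij_comp)
qed

lemma act12_sound:
  assumes "(s, t) \<in> Phi12_rels"
  shows "term_eval permutations act12 s = term_eval permutations act12 t"
proof -
  have bij: "bij act12_a" "bij act12_b" "bij act12_c"
    using bij_act12[of A5] bij_act12[of A6] bij_act12[of A2] by simp_all
  have "act12 i \<circ> act12 j = act12 j \<circ> act12 i" if "{i, j} \<notin> {{A4, A5}, {A3, A6}, {A5, A6}}" for i j
    using that
    by (cases i; cases j) (simp_all add: doubleton_eq_iff fun_eq_iff act12_a_def act12_b_def act12_c_def all_bool_eq)
  then have triv: "(s, t) \<in> trivial_comms {{A4, A5}, {A3, A6}, {A5, A6}} \<Longrightarrow> ?thesis"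
    by (intro trivial_comms_sound bij_act12)
  show ?thesis
  proof (cases "(s, t) \<in> trivial_comms {{A4, A5}, {A3, A6}, {A5, A6}}")
    case False
    have "bij (act12 i \<circ> act12 j)" for i j
      by (intro bij_comp bij_act12)
    with False assms show ?thesis
      unfolding Phi12_rels_def
      by (elim UnE insertE emptyE; simp only: prod.inject; simp only: term_eval.simps
          group.term_eval_Comm[OF group_permutations] permutations_commutator_eq bij_act12 permutations_simps;
          simp add: fun_eq_iff act12_a_def act12_b_def act12_c_def all_bool_eq)
  qed (rule triv)
qed

text \<open>The generators \<alpha>_5 and \<alpha>_6 serve as a and b: their squares are \<alpha>_3
  and \<alpha>_4, and their commutator \<alpha>_2 has square \<alpha>_1 and fourth power 1. It has
  order 4 as soon as \<alpha>_1 is nontrivial, which the model shows.\<close>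

lemma Phi12_presented_group:
  "commutator_pairing (presented_group Phi12_rels) Q12 D12 pairing12"
proof -
  let ?H = "presented_group Phi12_rels"
  interpret group ?H by (rule group_presented_group)
  define g where "g = pgen Phi12_rels"
  have gH: "g i \<in> carrier ?H" for i
    by (simp add: g_def)
  have sq: "g A1 \<otimes>\<^bsub>?H\<^esub> g A1 = \<one>\<^bsub>?H\<^esub>" "g A2 \<otimes>\<^bsub>?H\<^esub> g A2 = g A1" "g A5 \<otimes>\<^bsub>?H\<^esub> g A5 = g A3"
      "g A6 \<otimes>\<^bsub>?H\<^esub> g A6 = g A4"
    unfolding g_def presented_group_mult presented_group_one by (rule presented_group_rel; simp add: Phi12_rels_def)+
  have c: "commutator ?H (g A5) (g A6) = g A2"
    unfolding g_def presented_group_commutator by (rule presented_group_rel) (simp add: Phi12_rels_def)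
  have triv: "commutator ?H (g i) (g j) = \<one>\<^bsub>?H\<^esub>" if "{i, j} \<notin> {{A4, A5}, {A3, A6}, {A5, A6}}" for i j
    unfolding g_def presented_group_commutator presented_group_one
    using that by (intro presented_group_rel) (auto simp: Phi12_rels_def trivial_comms_def)
  have gen: "generate ?H (range g) = carrier ?H"
    unfolding g_def by (rule presented_group_generate)
  have central: "g A1 \<in> center ?H" "g A2 \<in> center ?H"
    using triv gH by (auto intro!: center_if_commutes_generators[OF _ gen] simp: doubleton_eq_iff)
  have gen': "generate ?H ({g A5, g A6} \<union> center ?H) = carrier ?H" (is "generate ?H ?S = _")
  proof (rule generate_eq_carrier_mono[OF gen])
    have "g i \<in> generate ?H ?S" for i
    proof (cases i)
      case A3
      then show ?thesis unfolding A3 sq(3)[symmetric] by (intro generate.eng generate.incl) auto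
    next
      case A4
      then show ?thesis unfolding A4 sq(4)[symmetric] by (intro generate.eng generate.incl) auto
    qed (use central in \<open>auto intro: generate.incl\<close>)
    then show "range g \<subseteq> generate ?H ?S" by blast
    show "?S \<subseteq> carrier ?H" using gH centerD(1) by auto
  qed
  have "class_two_group ?H"
    using c central gH commutator_swap[of "g A5" "g A6"]
    by (intro class_two_groupI[OF _ gen']) (auto simp: center_one_closed center_inv_closed)
  then interpret class_two_group ?H .
  show ?thesis
  proof (rule commutator_pairing12I[OF gH gH _ gen'])
    have "\<not> pres_eq Phi12_rels (Gen A1) One"
    proof
      assume "pres_eq Phi12_rels (Gen A1) One"
      then have "term_eval permutations act12 (Gen A1) = term_eval permutations act12 One"
        by (rule group.pres_eq_sound[OF group_permutations]) (simp_all only: act12_sound permutations_simps mem_Collect_eq bij_act12)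
      \<comment> \<open>\<alpha>_1 acts as t to t + 4, so it moves the origin.\<close>
      then have "act12 A1 (False, False, False, False, False) = id (False, False, False, False, False)"
        by simp
      then show False by (simp add: act12_c_def)
    qed
    then have "g A1 \<noteq> \<one>\<^bsub>?H\<^esub>"
      by (simp add: g_def presented_group_one pres_class_eq_iff)
    then show "ord (commutator ?H (g A5) (g A6)) = 4"
      unfolding c using gH sq by (intro ord_eq_4I) simp_all
  qed
qed

text \<open>
  A faithful action on \<open>\<int>/4 \<times> \<int>/4\<close>, written in binary: \<open>\<alpha>\<^sub>3\<close>, \<open>\<alpha>\<^sub>4\<close>, \<open>\<alpha>\<^sub>5\<close> and \<open>\<alpha>\<^sub>6\<close> are
  \<open>(x, y) \<mapsto> (x + 1, y)\<close>, \<open>(x, y + 1)\<close>, \<open>(3x + 2y, 3y)\<close> and \<open>(3x, 2x + 3y)\<close>.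
\<close>

type_synonym bits4 = "bool \<times> bool \<times> bool \<times> bool"

primrec act13 :: "gen6 \<Rightarrow> bits4 \<Rightarrow> bits4" where
  "act13 A1 = (\<lambda>(x1, x0, y1, y0). (\<not> x1, x0, y1, y0))"
| "act13 A2 = (\<lambda>(x1, x0, y1, y0). (x1, x0, \<not> y1, y0))"
| "act13 A3 = (\<lambda>(x1, x0, y1, y0). (x1 \<noteq> x0, \<not> x0, y1, y0))"
| "act13 A4 = (\<lambda>(x1, x0, y1, y0). (x1, x0, y1 \<noteq> y0, \<not> y0))"
| "act13 A5 = (\<lambda>(x1, x0, y1, y0). ((x1 \<noteq> x0) \<noteq> y0, x0, y1 \<noteq> y0, y0))"
| "act13 A6 = (\<lambda>(x1, x0, y1, y0). (x1 \<noteq> x0, x0, (y1 \<noteq> y0) \<noteq> x0, y0))"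

lemma bij_act13: "bij (act13 g)"
proof -
  have "act13 g \<circ> (act13 g \<circ> act13 g \<circ> act13 g) = id" "(act13 g \<circ> act13 g \<circ> act13 g) \<circ> act13 g = id"
    by (cases g; simp add: fun_eq_iff all_bool_eq)+
  then show ?thesis by (intro o_bij)
qed

lemma act13_sound:
  assumes "(s, t) \<in> Phi13_rels"
  shows "term_eval permutations act13 s = term_eval permutations act13 t"
proof -
  have "act13 i \<circ> act13 j = act13 j \<circ> act13 i" if "{i, j} \<notin> {{A3, A5}, {A4, A5}, {A3, A6}, {A4, A6}}" for i j
    using that by (cases i; cases j) (simp_all add: doubleton_eq_iff fun_eq_iff all_bool_eq)
  then have triv: "(s, t) \<in> trivial_comms {{A3, A5}, {A4, A5}, {A3, A6}, {A4, A6}} \<Longrightarrow> ?thesis"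
    by (intro trivial_comms_sound bij_act13)
  show ?thesis
  proof (cases "(s, t) \<in> trivial_comms {{A3, A5}, {A4, A5}, {A3, A6}, {A4, A6}}")
    case False
    have "bij (act13 i \<circ> act13 j)" for i j
      by (intro bij_comp bij_act13)
    with False assms show ?thesis
      unfolding Phi13_rels_def
      by (elim UnE insertE emptyE; simp only: prod.inject; simp only: term_eval.simps
          group.term_eval_Comm[OF group_permutations] permutations_commutator_eq bij_act13 permutations_simps;
          simp add: fun_eq_iff all_bool_eq)
  qed (rule triv)
qed

text \<open>The basis a, b, c, d is \<alpha>_3, \<alpha>_4, \<alpha>_5, \<alpha>_6, with p =
  \<alpha>_1 and q = \<alpha>_1 \<alpha>_2, so that p q = \<alpha>_2 as [\<alpha>_4, \<alpha>_6]
  demands.\<close>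

lemma Phi13_presented_group:
  "commutator_pairing (presented_group Phi13_rels) Q13 D13 pairing13"
proof -
  let ?H = "presented_group Phi13_rels"
  interpret group ?H by (rule group_presented_group)
  define g where "g = pgen Phi13_rels"
  have gH: "g i \<in> carrier ?H" for i
    by (simp add: g_def)
  have sq: "g A1 \<otimes>\<^bsub>?H\<^esub> g A1 = \<one>\<^bsub>?H\<^esub>" "g A2 \<otimes>\<^bsub>?H\<^esub> g A2 = \<one>\<^bsub>?H\<^esub>"
    unfolding g_def presented_group_mult presented_group_one by (rule presented_group_rel; simp add: Phi13_rels_def)+
  have comm: "commutator ?H (g A3) (g A5) = g A1" "commutator ?H (g A4) (g A6) = g A2"
      "commutator ?H (g A4) (g A5) = g A1 \<otimes>\<^bsub>?H\<^esub> g A2" "commutator ?H (g A3) (g A6) = g A1 \<otimes>\<^bsub>?H\<^esub> g A2"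
    unfolding g_def presented_group_commutator presented_group_mult
    by (rule presented_group_rel; simp add: Phi13_rels_def)+
  have triv: "commutator ?H (g i) (g j) = \<one>\<^bsub>?H\<^esub>" if "{i, j} \<notin> {{A3, A5}, {A4, A5}, {A3, A6}, {A4, A6}}" for i j
    unfolding g_def presented_group_commutator presented_group_one
    using that by (intro presented_group_rel) (auto simp: Phi13_rels_def trivial_comms_def)
  have gen: "generate ?H (range g) = carrier ?H"
    unfolding g_def by (rule presented_group_generate)
  have central: "g A1 \<in> center ?H" "g A2 \<in> center ?H"
    using triv gH by (auto intro!: center_if_commutes_generators[OF _ gen] simp: doubleton_eq_iff)
  have gen': "generate ?H ({g A3, g A4, g A5, g A6} \<union> center ?H) = carrier ?H" (is "generate ?H ?S = _")
  proof (rule generate_eq_carrier_mono[OF gen])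
    have "g i \<in> generate ?H ?S" for i
      using central by (cases i) (auto intro: generate.incl)
    then show "range g \<subseteq> generate ?H ?S" by blast
    show "?S \<subseteq> carrier ?H" using gH centerD(1) by auto
  qed
  have central': "g A1 \<otimes>\<^bsub>?H\<^esub> g A2 \<in> center ?H"
    using central by (rule center_mult_closed)
  have in_center: "commutator ?H (g i) (g j) \<in> center ?H" for i j
  proof (cases "{i, j} \<in> {{A3, A5}, {A4, A5}, {A3, A6}, {A4, A6}}")
    case True
    \<comment> \<open>The relations list each unordered pair in one order only; the other order
      gives the inverse.\<close>
    have "commutator ?H (g i) (g j) \<in> center ?H \<or> commutator ?H (g j) (g i) \<in> center ?H"
      using True comm central central' by (auto simp: doubleton_eq_iff)
    then show ?thesis
      using commutator_swap[OF gH gH, of i j] center_inv_closed gH commutator_swap[OF gH gH, of j i] by metis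
  qed (simp add: triv center_one_closed)
  have "class_two_group ?H"
    using in_center gH by (intro class_two_groupI[OF _ gen']) auto
  then interpret class_two_group ?H .
  have neq: "g A1 \<noteq> \<one>\<^bsub>?H\<^esub>" "g A2 \<noteq> \<one>\<^bsub>?H\<^esub>" "g A1 \<otimes>\<^bsub>?H\<^esub> g A2 \<noteq> \<one>\<^bsub>?H\<^esub>"
  proof -
    have "term_eval permutations act13 s = term_eval permutations act13 t" if "pres_eq Phi13_rels s t" for s t
      using that by (rule group.pres_eq_sound[OF group_permutations]) (simp_all only: act13_sound permutations_simps mem_Collect_eq bij_act13)
    from this[of "Gen A1" One] this[of "Gen A2" One] this[of "Gen A1 \<star> Gen A2" One]
    have "\<not> pres_eq Phi13_rels (Gen A1) One" "\<not> pres_eq Phi13_rels (Gen A2) One"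
      "\<not> pres_eq Phi13_rels (Gen A1 \<star> Gen A2) One"
      by (auto simp: fun_eq_iff)
    then show "g A1 \<noteq> \<one>\<^bsub>?H\<^esub>" "g A2 \<noteq> \<one>\<^bsub>?H\<^esub>" "g A1 \<otimes>\<^bsub>?H\<^esub> g A2 \<noteq> \<one>\<^bsub>?H\<^esub>"
      by (simp_all add: g_def presented_group_one presented_group_mult pres_class_eq_iff)
  qed
  have sq12: "g A1 \<otimes>\<^bsub>?H\<^esub> g A2 \<otimes>\<^bsub>?H\<^esub> (g A1 \<otimes>\<^bsub>?H\<^esub> g A2) = \<one>\<^bsub>?H\<^esub>"
  proof -
    have "g A1 \<otimes>\<^bsub>?H\<^esub> g A2 \<otimes>\<^bsub>?H\<^esub> (g A1 \<otimes>\<^bsub>?H\<^esub> g A2) = g A1 \<otimes>\<^bsub>?H\<^esub> (g A2 \<otimes>\<^bsub>?H\<^esub> g A1) \<otimes>\<^bsub>?H\<^esub> g A2"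
      using gH by (simp add: m_assoc)
    also have "g A2 \<otimes>\<^bsub>?H\<^esub> g A1 = g A1 \<otimes>\<^bsub>?H\<^esub> g A2"
      by (rule centerD(2)[OF central(2) gH])
    also have "g A1 \<otimes>\<^bsub>?H\<^esub> (g A1 \<otimes>\<^bsub>?H\<^esub> g A2) \<otimes>\<^bsub>?H\<^esub> g A2 = (g A1 \<otimes>\<^bsub>?H\<^esub> g A1) \<otimes>\<^bsub>?H\<^esub> (g A2 \<otimes>\<^bsub>?H\<^esub> g A2)"
      using gH by (simp add: m_assoc)
    finally show ?thesis by (simp add: sq)
  qed
  have pq: "g A1 \<otimes>\<^bsub>?H\<^esub> (g A1 \<otimes>\<^bsub>?H\<^esub> g A2) = g A2"
    using gH by (simp add: sq flip: m_assoc)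
  show ?thesis
  proof (rule commutator_pairing13I[OF gH gH gH gH _ _ comm(1,4,3) _ neq(1,3) _ sq(1) sq12 gen'])
    show "g A1 \<noteq> g A1 \<otimes>\<^bsub>?H\<^esub> g A2" using neq gH by simp
  qed (simp_all add: triv doubleton_eq_iff pq comm)
qed

section \<open>Class preserving and central automorphisms\<close>

context group
begin

lemma class_preserving_conv:
  "\<alpha> \<in> class_preserving_auts G \<longleftrightarrow>
    \<alpha> \<in> auto G \<and> (\<forall>x\<in>carrier G. \<exists>g\<in>carrier G. \<alpha> x = x \<otimes> commutator G x g)"
  by (auto simp: class_preserving_auts_def mult_commutator)

lemma autD:
  assumes "\<alpha> \<in> auto G"
  shows "\<alpha> \<in> hom G G" "bij_betw \<alpha> (carrier G) (carrier G)" "x \<in> carrier G \<Longrightarrow> \<alpha> x \<in> carrier G"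
  using assms by (auto simp: auto_def Bij_def hom_def)

lemma autI:
  assumes "f \<in> hom G G" "bij_betw f (carrier G) (carrier G)"
  shows "restrict f (carrier G) \<in> auto G"
proof -
  have "restrict f (carrier G) \<in> hom G G"
    using assms(1) by (auto simp: hom_def)
  moreover have "bij_betw (restrict f (carrier G)) (carrier G) (carrier G)"
    using assms(2) bij_betw_cong[of "carrier G" "restrict f (carrier G)" f] by simp
  ultimately show ?thesis by (simp add: auto_def Bij_def)
qed

lemma conjugation_class_preserving:
  assumes g: "g \<in> carrier G"
  shows "(\<lambda>x\<in>carrier G. inv g \<otimes> x \<otimes> g) \<in> class_preserving_auts G"
proof -
  have "(\<lambda>x. inv g \<otimes> x \<otimes> g) \<in> hom G G"
    using g by (auto simp: hom_def m_assoc)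
  moreover have "bij_betw (\<lambda>x. inv g \<otimes> x \<otimes> g) (carrier G) (carrier G)"
    using g by (intro bij_betwI[where g = "\<lambda>x. g \<otimes> x \<otimes> inv g"]) (auto simp: m_assoc)
  ultimately show ?thesis
    using g autI by (auto simp: class_preserving_auts_def)
qed

lemma class_two_if_class_preserving_central:
  assumes "class_preserving_auts G \<subseteq> central_auts G"
  shows "class_two_group G"
proof (intro class_two_group.intro class_two_group_axioms.intro is_group)
  fix x y assume xy: "x \<in> carrier G" "y \<in> carrier G"
  have "inv x \<otimes> (\<lambda>x\<in>carrier G. inv y \<otimes> x \<otimes> y) x \<in> center G"
    using conjugation_class_preserving[OF xy(2)] assms xy(1) unfolding central_auts_def by blast
  then show "commutator G x y \<in> center G"
    using xy by (simp add: commutator_def m_assoc)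
qed

lemma central_aut_hom:
  assumes "\<phi> \<in> central_auts G"
  shows "(\<lambda>x. inv x \<otimes> \<phi> x) \<in> hom G G"
proof (rule homI)
  have \<phi>: "\<phi> \<in> hom G G" "\<And>x. x \<in> carrier G \<Longrightarrow> \<phi> x \<in> carrier G"
    and central: "\<And>x. x \<in> carrier G \<Longrightarrow> inv x \<otimes> \<phi> x \<in> center G"
    using assms autD by (auto simp: central_auts_def)
  show "inv x \<otimes> \<phi> x \<in> carrier G" if "x \<in> carrier G" for x
    using that \<phi> by simp
  fix x y assume xy: "x \<in> carrier G" "y \<in> carrier G"
  have "inv (x \<otimes> y) \<otimes> \<phi> (x \<otimes> y) = inv y \<otimes> (inv x \<otimes> \<phi> x) \<otimes> \<phi> y"
    using xy \<phi> by (simp add: hom_mult inv_mult_group m_assoc)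
  also have "inv y \<otimes> (inv x \<otimes> \<phi> x) = inv x \<otimes> \<phi> x \<otimes> inv y"
    using centerD(2)[OF central[OF xy(1)], of "inv y"] xy by simp
  finally show "inv (x \<otimes> y) \<otimes> \<phi> (x \<otimes> y) = (inv x \<otimes> \<phi> x) \<otimes> (inv y \<otimes> \<phi> y)"
    using xy \<phi> by (simp add: m_assoc)
qed

text \<open>If x f(x) = 1, then x is the inverse of a central element, so the kernel of x to x f(x)
  lies in the centre. Injectivity therefore has to be tested only there, and finiteness turns it
  into bijectivity.\<close>

lemma central_aut_of_hom:
  assumes fin: "finite (carrier G)" and f: "f \<in> hom G G" "\<And>x. x \<in> carrier G \<Longrightarrow> f x \<in> center G"
    and inj: "\<And>x. \<lbrakk>x \<in> center G; x \<otimes> f x = \<one>\<rbrakk> \<Longrightarrow> x = \<one>"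
  shows "(\<lambda>x\<in>carrier G. x \<otimes> f x) \<in> central_auts G"
proof -
  let ?h = "\<lambda>x. x \<otimes> f x"
  have fG: "f x \<in> carrier G" if "x \<in> carrier G" for x
    using f(2) that centerD(1) by blast
  have hom: "?h \<in> hom G G"
  proof (rule homI)
    fix x y assume xy: "x \<in> carrier G" "y \<in> carrier G"
    have "x \<otimes> y \<otimes> f (x \<otimes> y) = x \<otimes> (y \<otimes> f x) \<otimes> f y"
      using xy fG by (simp add: hom_mult[OF f(1)] m_assoc)
    also have "y \<otimes> f x = f x \<otimes> y"
      using centerD(2)[OF f(2)[OF xy(1)] xy(2)] by simp
    finally show "x \<otimes> y \<otimes> f (x \<otimes> y) = x \<otimes> f x \<otimes> (y \<otimes> f y)"
      using xy fG by (simp add: m_assoc)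
  qed (use fG in simp)
  interpret h: group_hom G G ?h
    using hom by (simp add: group_hom_def group_hom_axioms_def is_group)
  have "x = \<one>" if x: "x \<in> carrier G" "x \<otimes> f x = \<one>" for x
  proof -
    have "x = inv (f x)"
      using x fG by (metis inv_equality)
    then have "x \<in> center G"
      using center_inv_closed[OF f(2)[OF x(1)]] by simp
    then show ?thesis using inj x by blast
  qed
  then have "inj_on ?h (carrier G)"
    unfolding h.inj_on_one_iff by blast
  then have "bij_betw ?h (carrier G) (carrier G)"
    using endo_inj_surj[OF fin, of ?h] h.hom_closed unfolding bij_betw_def by blast
  moreover have "inv x \<otimes> (x \<otimes> f x) \<in> center G" if "x \<in> carrier G" for x
    using that f fG by simp
  ultimately show ?thesis
    using autI[OF hom] by (simp add: central_auts_def)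
qed

lemma hom_values_commutators:
  assumes "class_preserving_auts G = central_auts G"
    and "finite (carrier G)" "f \<in> hom G G" "\<And>x. x \<in> carrier G \<Longrightarrow> f x \<in> center G"
    and "\<And>x. \<lbrakk>x \<in> center G; x \<otimes> f x = \<one>\<rbrakk> \<Longrightarrow> x = \<one>" and x: "x \<in> carrier G"
  shows "\<exists>g\<in>carrier G. f x = commutator G x g"
proof -
  have "(\<lambda>x\<in>carrier G. x \<otimes> f x) \<in> class_preserving_auts G"
    unfolding assms(1) by (rule central_aut_of_hom[OF assms(2,3)]) (rule assms(4,5); assumption)+
  then obtain g where g: "g \<in> carrier G" "x \<otimes> f x = x \<otimes> commutator G x g"
    unfolding class_preserving_conv using x by auto
  have "f x \<in> carrier G"
    using assms(4)[OF x] by (rule centerD(1))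
  then have "f x = commutator G x g"
    using l_cancel[OF g(2)] x g(1) by auto
  then show ?thesis using g by blast
qed

text \<open>The order condition upgrades the inclusion of \<gamma>_2(G) in Z(G) to equality, since
  |Z(G)| |Q| = |G| = |Q| |D|. For a central automorphism, x to x^-1 \<phi>(x) has central values, so
  it kills \<gamma>_2(G) = Z(G) and descends to a homomorphism from \<open>Q\<close> to
  \<open>D\<close>, to which \<open>represents\<close> applies.\<close>

lemma class_preserving_eq_central_if_pairing:
  assumes pairing: "commutator_pairing G Q D \<omega>" and Q: "comm_group Q" and D: "group D"
    and order: "order G = card (carrier Q) * card (carrier D)" "order G > 0"
    and represents: "\<And>f x. \<lbrakk>f \<in> hom Q D; x \<in> carrier Q\<rbrakk> \<Longrightarrow> \<exists>y\<in>carrier Q. f x = \<omega> x y"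
  shows "class_preserving_auts G = central_auts G"
proof -
  obtain \<pi> \<epsilon> where \<pi>: "\<pi> \<in> hom G Q" "\<pi> ` carrier G = carrier Q" "kernel G Q \<pi> = center G"
    and \<epsilon>: "\<epsilon> \<in> iso D (G\<lparr>carrier := commutator_subgroup G\<rparr>)"
    and \<pi>\<epsilon>: "\<And>x y. \<lbrakk>x \<in> carrier G; y \<in> carrier G\<rbrakk> \<Longrightarrow> commutator G x y = \<epsilon> (\<omega> (\<pi> x) (\<pi> y))"
    using pairing unfolding commutator_pairing_def by blast
  interpret Q: comm_group Q by (rule Q)
  interpret \<pi>: group_hom G Q \<pi>
    using \<pi> by (simp add: group_hom_def group_hom_axioms_def is_group Q.is_group)
  have fin: "finite (carrier G)"
    using order(2) by (simp add: order_gt_0_iff_finite)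
  \<comment> \<open>Commutators die in the abelian group \<open>Q\<close>, and the kernel of
    \<open>\<pi>\<close> is the centre.\<close>
  have central: "commutator G x y \<in> center G" if xy: "x \<in> carrier G" "y \<in> carrier G" for x y
  proof -
    have "\<pi> (commutator G x y) = inv\<^bsub>Q\<^esub> \<pi> x \<otimes>\<^bsub>Q\<^esub> \<pi> x \<otimes>\<^bsub>Q\<^esub> (inv\<^bsub>Q\<^esub> \<pi> y \<otimes>\<^bsub>Q\<^esub> \<pi> y)"
      using xy by (simp add: commutator_def Q.m_ac)
    then have "commutator G x y \<in> kernel G Q \<pi>"
      using xy by (simp add: kernel_def)
    then show ?thesis by (simp add: \<pi>)
  qed
  have "class_two_group G"
    by (simp add: class_two_group_def class_two_group_axioms_def is_group central)
  then interpret class_two_group G .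
  have "card (center G) * card (carrier Q) = order G"
    using \<pi>.card_kernel_times_image[OF fin] \<pi> by simp
  moreover have "card (commutator_subgroup G) = card (carrier D)"
    using \<epsilon> by (auto simp: iso_def dest: bij_betw_same_card)
  ultimately have "card (center G) = card (commutator_subgroup G)"
    using order by (simp add: mult.commute)
  then have Z: "center G = commutator_subgroup G"
    using card_subset_eq[OF _ derived_subset_center] finite_subset[OF _ fin] subgroup.subset[OF center_subgroup] by metis
  have "central_auts G \<subseteq> class_preserving_auts G"
  proof
    fix \<phi> assume \<phi>: "\<phi> \<in> central_auts G"
    define f where "f x = inv x \<otimes> \<phi> x" for x
    have f: "f \<in> hom G G"
      using central_aut_hom[OF \<phi>] by (simp add: f_def[abs_def])
    have fZ: "f x \<in> center G" if "x \<in> carrier G" for x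
      using \<phi> that by (simp add: central_auts_def f_def)
    interpret f: group_hom G G f
      using f by (simp add: group_hom_def group_hom_axioms_def is_group)
    have "subgroup (kernel G G f) G"
      by (rule f.subgroup_kernel)
    moreover have "f (commutator G x y) = \<one>" if "x \<in> carrier G" "y \<in> carrier G" for x y
    proof -
      have "f (commutator G x y) = commutator G (f x) (f y)"
        using that by (simp add: commutator_def)
      then show ?thesis
        using that fZ by (simp add: commutator_center)
    qed
    ultimately have "commutator_subgroup G \<subseteq> kernel G G f"
      by (intro derived_minimal) (auto simp: kernel_def)
    then have f_center: "f z = \<one>" if "z \<in> center G" for z
      using that Z by (auto simp: kernel_def)
    have f_eq: "f x = f y" if xy: "x \<in> carrier G" "y \<in> carrier G" "\<pi> x = \<pi> y" for x y
    proof -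
      have "\<pi> (x \<otimes> inv y) = \<one>\<^bsub>Q\<^esub>"
        using xy by simp
      then have "x \<otimes> inv y \<in> center G"
        using xy by (simp flip: \<pi>(3) add: kernel_def)
      then have "f (x \<otimes> inv y) = \<one>"
        by (rule f_center)
      then have "f x \<otimes> inv (f y) = \<one>"
        using xy by simp
      then show ?thesis
        using inv_equality[of "f x" "inv (f y)"] xy by simp
    qed
    define lg where "lg = inv_into (carrier D) \<epsilon>"
    define F where "F q = lg (f (inv_into (carrier G) \<pi> q))" for q
    have F_\<pi>: "F (\<pi> x) = lg (f x)" if "x \<in> carrier G" for x
    proof -
      have "\<pi> x \<in> \<pi> ` carrier G" using that by blast
      then show ?thesis
        unfolding F_def using f_eq that by (metis f_inv_into_f inv_into_into)
    qed
    have "lg \<in> hom (G\<lparr>carrier := commutator_subgroup G\<rparr>) D"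
      using group.iso_set_sym[OF D \<epsilon>] by (simp add: lg_def iso_def)
    moreover have "f \<in> hom G (G\<lparr>carrier := commutator_subgroup G\<rparr>)"
      using f fZ Z by (auto simp: hom_def)
    ultimately have lgf: "lg \<circ> f \<in> hom G D"
      by (rule Group.hom_compose[rotated])
    have F: "F \<in> hom Q D"
    proof (rule homI)
      fix q assume "q \<in> carrier Q"
      then obtain x where "x \<in> carrier G" "q = \<pi> x" using \<pi> by blast
      then show "F q \<in> carrier D" using lgf by (auto simp: F_\<pi> hom_def)
    next
      fix q r assume "q \<in> carrier Q" "r \<in> carrier Q"
      then obtain x y where xy: "x \<in> carrier G" "q = \<pi> x" "y \<in> carrier G" "r = \<pi> y" using \<pi> by blast
      then have "F (q \<otimes>\<^bsub>Q\<^esub> r) = F (\<pi> (x \<otimes> y))" by simp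
      also have "\<dots> = F q \<otimes>\<^bsub>D\<^esub> F r"
        using xy hom_mult[OF lgf] by (simp add: F_\<pi> del: \<pi>.hom_mult f.hom_mult)
      finally show "F (q \<otimes>\<^bsub>Q\<^esub> r) = F q \<otimes>\<^bsub>D\<^esub> F r" .
    qed
    have "\<exists>g\<in>carrier G. \<phi> x = x \<otimes> commutator G x g" if x: "x \<in> carrier G" for x
    proof -
      obtain y where y: "y \<in> carrier Q" "F (\<pi> x) = \<omega> (\<pi> x) y"
        using represents[OF F] x by (metis \<pi>.hom_closed)
      then obtain g where g: "g \<in> carrier G" "y = \<pi> g" using \<pi> by blast
      have "f x \<in> \<epsilon> ` carrier D"
        using fZ[OF x] Z \<epsilon> by (simp add: iso_def bij_betw_def)
      then have "f x = \<epsilon> (lg (f x))"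
        by (simp add: lg_def f_inv_into_f)
      also have "\<dots> = commutator G x g"
        using y g x by (simp add: \<pi>\<epsilon> F_\<pi>)
      finally have "x \<otimes> commutator G x g = x \<otimes> (inv x \<otimes> \<phi> x)"
        by (simp add: f_def)
      also have "\<dots> = \<phi> x"
        using x \<phi> autD(3)[of \<phi> x] by (simp add: central_auts_def)
      finally have "\<phi> x = x \<otimes> commutator G x g" ..
      then show ?thesis using g by blast
    qed
    then show "\<phi> \<in> class_preserving_auts G"
      using \<phi> by (simp add: class_preserving_conv central_auts_def)
  qed
  moreover have "class_preserving_auts G \<subseteq> central_auts G"
  proof
    fix \<alpha> assume \<alpha>: "\<alpha> \<in> class_preserving_auts G"
    have "inv x \<otimes> \<alpha> x \<in> center G" if "x \<in> carrier G" for x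
    proof -
      obtain g where "g \<in> carrier G" "\<alpha> x = x \<otimes> commutator G x g"
        using \<alpha> \<open>x \<in> carrier G\<close> unfolding class_preserving_conv by blast
      then show ?thesis using that commutator_central by simp
    qed
    then show "\<alpha> \<in> central_auts G"
      using \<alpha> by (simp add: class_preserving_conv central_auts_def)
  qed
  ultimately show ?thesis by blast
qed

lemma card_Q_D: "card (carrier Q12) = 16" "card (carrier D12) = 4" "card (carrier Q13) = 16" "card (carrier D13) = 4"
  by (simp_all add: card_cartesian_product carrier_integer_mod_group card_UNIV_bool del: UNIV_Times_UNIV)

lemma class_preserving_eq_central_if_Phi:
  assumes "in_Phi12 G \<or> in_Phi13 G"
  shows "class_preserving_auts G = central_auts G"
  using assms
proof
  assume "in_Phi12 G"
  then have "order G = 64" "commutator_pairing G Q12 D12 pairing12"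
    using commutator_pairing_isoclinic[OF is_group group_presented_group _ _ Phi12_presented_group] Q12_group
    by (auto simp: in_Phi12_def comm_group_def)
  then show ?thesis
    using Q12_group pairing12_represents_homs
    by (intro class_preserving_eq_central_if_pairing) (assumption | simp add: card_Q_D del: carrier_DirProd)+
next
  assume "in_Phi13 G"
  then have "order G = 64" "commutator_pairing G Q13 D13 pairing13"
    using commutator_pairing_isoclinic[OF is_group group_presented_group _ _ Phi13_presented_group] Q13_group
    by (auto simp: in_Phi13_def comm_group_def)
  then show ?thesis
    using Q13_group D13_group pairing13_represents_homs
    by (intro class_preserving_eq_central_if_pairing) (assumption | simp add: card_Q_D del: carrier_DirProd)+
qed

end

section \<open>Groups of order 64 all of whose central automorphisms preserve classes\<close>

context group
begin

text \<open>When \<open>M\<close> is normal, the image of \<open>x\<close> lies in every nontrivial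
  subgroup of the quotient. A finite abelian 2-group with such an element is cyclic, which is how
  small cyclic quotients detecting \<open>x\<close> arise below.\<close>

lemma maximal_subgroup_avoiding:
  assumes "finite (carrier G)" "subgroup B G" "x \<notin> B"
  obtains M where "subgroup M G" "B \<subseteq> M" "x \<notin> M" "\<And>N. \<lbrakk>subgroup N G; M \<subset> N\<rbrakk> \<Longrightarrow> x \<in> N"
proof -
  let ?A = "{M. subgroup M G \<and> B \<subseteq> M \<and> x \<notin> M}"
  have "finite ?A"
    using finite_subset[of ?A "Pow (carrier G)"] assms(1) subgroup.subset by auto
  moreover have "B \<in> ?A"
    using assms by simp
  ultimately obtain M where "M \<in> ?A" "\<forall>N\<in>?A. M \<subseteq> N \<longrightarrow> M = N"
    using finite_has_maximal2[of ?A B] by blast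
  then show ?thesis
    using that[of M] by blast
qed

lemma quotient_map:
  assumes "N \<lhd> G"
  defines "r \<equiv> \<lambda>x. N #> x"
  shows "group (G Mod N)" "group_hom G (G Mod N) r" "x \<in> carrier G \<Longrightarrow> r x = \<one>\<^bsub>G Mod N\<^esub> \<longleftrightarrow> x \<in> N"
proof -
  interpret N: normal N G by (rule assms(1))
  show K: "group (G Mod N)"
    by (rule N.factorgroup_is_group)
  show "group_hom G (G Mod N) r"
    using K N.r_coset_hom_Mod by (simp add: group_hom_def group_hom_axioms_def is_group r_def)
  show "r x = \<one>\<^bsub>G Mod N\<^esub> \<longleftrightarrow> x \<in> N" if "x \<in> carrier G"
    using N.rcos_const[OF is_group, of x] rcos_self[OF that N.is_subgroup] by (auto simp: r_def)
qed

text \<open>The union of \<open>N\<close> and N y is a subgroup properly above \<open>N\<close>, so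
  it contains \<open>x\<close>, and \<open>x\<close> can only lie in the second coset. Thus the
  quotient has at most one involution.\<close>

lemma maximal_avoiding_quotient:
  assumes N: "N \<lhd> G" and max: "\<And>M. \<lbrakk>subgroup M G; N \<subset> M\<rbrakk> \<Longrightarrow> x \<in> M"
    and x: "x \<in> carrier G" "x \<notin> N" and y: "y \<in> carrier G" "y \<otimes> y \<in> N" "y \<notin> N"
  shows "N #> y = N #> x"
proof -
  define r where "r u = N #> u" for u
  define K where "K = G Mod N"
  interpret r: group_hom G K r
    using quotient_map(2)[OF N] by (simp add: r_def[abs_def] K_def)
  have r_one: "r u = \<one>\<^bsub>K\<^esub> \<longleftrightarrow> u \<in> N" if "u \<in> carrier G" for u
    using quotient_map(3)[OF N that] by (simp add: r_def K_def)
  have ry: "r y \<in> carrier K" "r y \<otimes>\<^bsub>K\<^esub> r y = \<one>\<^bsub>K\<^esub>" "inv\<^bsub>K\<^esub> r y = r y"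
    using y r_one[of "y \<otimes> y"] r.H.inv_equality[of "r y" "r y"] by auto
  let ?M = "{u \<in> carrier G. r u \<in> {\<one>\<^bsub>K\<^esub>, r y}}"
  have "subgroup ?M G"
  proof (rule subgroupI)
    fix a assume a: "a \<in> ?M"
    then have "a \<in> carrier G" "r a = \<one>\<^bsub>K\<^esub> \<or> r a = r y" by simp_all
    moreover from this have "r (inv a) = inv\<^bsub>K\<^esub> r a"
      by (intro r.hom_inv)
    ultimately have "r (inv a) = \<one>\<^bsub>K\<^esub> \<or> r (inv a) = r y"
      using ry(3) r.H.inv_one by metis
    then show "inv a \<in> ?M"
      using \<open>a \<in> carrier G\<close> by simp
  next
    fix a b assume "a \<in> ?M" "b \<in> ?M"
    then have ab: "a \<in> carrier G" "b \<in> carrier G" "r a = \<one>\<^bsub>K\<^esub> \<or> r a = r y" "r b = \<one>\<^bsub>K\<^esub> \<or> r b = r y"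
      by simp_all
    have "r (a \<otimes> b) = r a \<otimes>\<^bsub>K\<^esub> r b"
      using ab(1,2) by (rule r.hom_mult)
    then have "r (a \<otimes> b) = \<one>\<^bsub>K\<^esub> \<or> r (a \<otimes> b) = r y"
      using ab(3,4) ry(1,2) r.H.l_one r.H.r_one r.H.one_closed by metis
    then show "a \<otimes> b \<in> ?M"
      using ab(1,2) by simp
  next
    have "\<one> \<in> ?M" by simp
    then show "?M \<noteq> {}" by blast
  qed auto
  moreover have "N \<subset> ?M"
  proof -
    have "N \<subseteq> ?M"
      using r_one subgroup.mem_carrier[OF normal_imp_subgroup[OF N]] by blast
    moreover have "y \<in> ?M" using y(1) by simp
    ultimately show ?thesis using y(3) by blast
  qed
  ultimately have "x \<in> ?M"
    by (rule max)
  then show ?thesis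
    using r_one[OF x(1)] x(2) by (simp add: r_def)
qed

text \<open>The exponent of a coset is determined only modulo the order of the generator
  \<open>r g\<close>; \<open>ord\<close> makes the power of \<open>w\<close> independent of the
  choice taken by \<open>SOME\<close>.\<close>

lemma hom_of_cyclic_quotient:
  assumes r: "group_hom G K r" and g: "g \<in> carrier G" and w: "w \<in> carrier G"
    and cyclic: "\<forall>y\<in>carrier G. \<exists>k::int. r y = r g [^]\<^bsub>K\<^esub> k"
    and ord: "\<forall>k::int. r g [^]\<^bsub>K\<^esub> k = \<one>\<^bsub>K\<^esub> \<longrightarrow> w [^] k = \<one>"
  shows "\<exists>f\<in>hom G G. \<forall>y\<in>carrier G. \<forall>k::int. r y = r g [^]\<^bsub>K\<^esub> k \<longrightarrow> f y = w [^] k"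
proof -
  interpret r: group_hom G K r by (rule r)
  define f where "f y = w [^] (SOME k::int. r y = r g [^]\<^bsub>K\<^esub> k)" for y
  have eq: "w [^] k = w [^] l" if kl: "r g [^]\<^bsub>K\<^esub> k = r g [^]\<^bsub>K\<^esub> l" for k l :: int
  proof -
    have "r g [^]\<^bsub>K\<^esub> (k - l) = \<one>\<^bsub>K\<^esub>"
      using g kl by (simp add: r.H.int_pow_diff)
    then have "w [^] (k - l) = \<one>"
      using ord by blast
    then show ?thesis
      using w by (simp add: int_pow_eq_id int_pow_eq) (metis dvd_minus_iff minus_diff_eq)
  qed
  have f: "f y = w [^] k" if "y \<in> carrier G" "r y = r g [^]\<^bsub>K\<^esub> k" for y and k :: int
  proof -
    have "r y = r g [^]\<^bsub>K\<^esub> (SOME k::int. r y = r g [^]\<^bsub>K\<^esub> k)"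
      using that(2) by (rule someI)
    then show ?thesis
      unfolding f_def using eq that(2) by metis
  qed
  moreover have "f \<in> hom G G"
  proof (rule homI)
    fix x y assume xy: "x \<in> carrier G" "y \<in> carrier G"
    obtain k l :: int where kl: "r x = r g [^]\<^bsub>K\<^esub> k" "r y = r g [^]\<^bsub>K\<^esub> l"
      using cyclic xy by meson
    then have "r (x \<otimes> y) = r g [^]\<^bsub>K\<^esub> (k + l)"
      using xy g by (simp add: r.H.int_pow_mult)
    then have "f (x \<otimes> y) = w [^] (k + l)"
      using xy by (intro f) simp_all
    then show "f (x \<otimes> y) = f x \<otimes> f y"
      using f[OF xy(1) kl(1)] f[OF xy(2) kl(2)] w by (simp add: int_pow_mult)
  qed (simp add: f_def w)
  ultimately show ?thesis by blast
qed

lemma int_pow_even: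
  assumes "x \<in> carrier G" "x \<otimes> x = \<one>" "even (k::int)"
  shows "x [^] k = \<one>"
proof -
  obtain j where "k = j + j"
    using assms(3) by (metis evenE mult_2)
  moreover have "x [^] (j + j) = (x \<otimes> x) [^] j"
    using assms(1) int_pow_mult[of x j j] int_pow_mult_distrib[of x x j] by metis
  ultimately show ?thesis
    using assms(2) by simp
qed

lemma even_if_int_pow:
  assumes "x \<in> carrier G" "x \<otimes> x = \<one>" "x \<noteq> \<one>" "x [^] (k::int) = \<one>"
  shows "even k"
proof (rule ccontr)
  assume "odd k"
  then have "x [^] ((k - 1) + 1) = x"
    using assms int_pow_even[of x "k - 1"] by (subst int_pow_mult) auto
  then show False using assms by simp
qed

lemma int_pow_2: "x \<in> carrier G \<Longrightarrow> x [^] (2::int) = x \<otimes> x"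
  using int_pow_mult[of x 1 1] by simp

end

lemma (in class_two_group) square_mult:
  assumes "x \<in> carrier G" "y \<in> carrier G"
  shows "(x \<otimes> y) \<otimes> (x \<otimes> y) = (x \<otimes> x) \<otimes> (y \<otimes> y) \<otimes> commutator G y x"
proof -
  have "(x \<otimes> y) \<otimes> (x \<otimes> y) = x \<otimes> (y \<otimes> x) \<otimes> y"
    using assms by (simp add: m_assoc)
  also have "y \<otimes> x = x \<otimes> y \<otimes> commutator G y x"
    using assms by (rule swap_commutator[rotated])
  also have "x \<otimes> (x \<otimes> y \<otimes> commutator G y x) \<otimes> y = x \<otimes> x \<otimes> y \<otimes> (commutator G y x \<otimes> y)"
    using assms by (simp add: m_assoc)
  also have "commutator G y x \<otimes> y = y \<otimes> commutator G y x"
    using assms by (intro centerD(2) commutator_central)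
  finally show ?thesis
    using assms by (simp add: m_assoc)
qed

section \<open>The case in which all commutators have order at most two\<close>

locale elementary_commutators = class_two_group +
  assumes commutator_square: "\<lbrakk>x \<in> carrier G; y \<in> carrier G\<rbrakk> \<Longrightarrow> commutator G x y \<otimes> commutator G x y = \<one>"
    and aut_eq: "class_preserving_auts G = central_auts G"
    and order_64: "order G = 64"
begin

lemma fin: "finite (carrier G)"
  using order_64 order_gt_0_iff_finite by simp

lemma commutator_sym: "\<lbrakk>x \<in> carrier G; y \<in> carrier G\<rbrakk> \<Longrightarrow> commutator G y x = commutator G x y"
  using commutator_square inv_equality[of "commutator G x y" "commutator G x y"] by (simp add: commutator_swap[of x y])

lemma square_central:
  assumes "x \<in> carrier G" shows "x \<otimes> x \<in> center G"
  unfolding center_iff_commutator using assms by (simp add: commutator_mult_left commutator_square)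

text \<open>Squares are central, so a subgroup \<open>M\<close> above the centre that is maximal
  without \<open>x\<close> has a quotient of order two. Sending its nontrivial coset to
  \<open>u\<close> defines a homomorphism that vanishes on the centre and takes \<open>x\<close> to
  \<open>u\<close>; the resulting central automorphism must preserve the class of
  \<open>x\<close>.\<close>

lemma commutator_values:
  assumes x: "x \<in> carrier G" "x \<notin> center G" and u: "u \<in> center G" "u \<otimes> u = \<one>"
  shows "\<exists>y\<in>carrier G. u = commutator G x y"
proof -
  obtain M where M: "subgroup M G" "center G \<subseteq> M" "x \<notin> M"
    and max: "\<And>N. \<lbrakk>subgroup N G; M \<subset> N\<rbrakk> \<Longrightarrow> x \<in> N"
    using maximal_subgroup_avoiding[OF fin center_subgroup x(2)] by blast
  have normal: "M \<lhd> G"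
    using M commutator_central by (intro normal_if_commutators) auto
  define r where "r v = M #> v" for v
  define K where "K = G Mod M"
  interpret r: group_hom G K r
    using quotient_map(2)[OF normal] by (simp add: r_def[abs_def] K_def)
  have r_one: "r v = \<one>\<^bsub>K\<^esub> \<longleftrightarrow> v \<in> M" if "v \<in> carrier G" for v
    using quotient_map(3)[OF normal that] by (simp add: r_def K_def)
  have rxx: "r x \<otimes>\<^bsub>K\<^esub> r x = \<one>\<^bsub>K\<^esub>"
    using r_one[of "x \<otimes> x"] square_central[OF x(1)] M x(1) by auto
  have uG: "u \<in> carrier G" using u centerD(1) by blast
  have r_cases: "r y = \<one>\<^bsub>K\<^esub> \<or> r y = r x" if "y \<in> carrier G" for y
    using maximal_avoiding_quotient[OF normal max x(1) M(3) that] square_central[OF that] M(2) r_one[OF that]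
    unfolding r_def by blast
  have cyc: "\<forall>y\<in>carrier G. \<exists>k::int. r y = r x [^]\<^bsub>K\<^esub> k"
    using r_cases x(1) r.H.int_pow_1 by (metis r.hom_closed int_pow_0)
  have uk: "\<forall>k::int. r x [^]\<^bsub>K\<^esub> k = \<one>\<^bsub>K\<^esub> \<longrightarrow> u [^] k = \<one>"
    using r.H.even_if_int_pow[OF _ rxx] r_one[OF x(1)] M(3) x(1) int_pow_even[OF uG u(2)] by auto
  obtain f where f: "f \<in> hom G G"
    and f_eq: "\<And>(k::int) y. \<lbrakk>y \<in> carrier G; r y = r x [^]\<^bsub>K\<^esub> k\<rbrakk> \<Longrightarrow> f y = u [^] k"
    using hom_of_cyclic_quotient[OF r.group_hom_axioms x(1) uG cyc uk] by blast
  have f_one: "f y = \<one>" if "y \<in> carrier G" "r y = \<one>\<^bsub>K\<^esub>" for y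
    using f_eq[of y 0] that by simp
  have f_x: "f y = u" if "y \<in> carrier G" "r y = r x" for y
    using f_eq[of y 1] that x(1) uG by simp
  have "\<exists>g\<in>carrier G. f x = commutator G x g"
  proof (rule hom_values_commutators[OF aut_eq fin f])
    show "f y \<in> center G" if "y \<in> carrier G" for y
      using r_cases[OF that] f_one[OF that] f_x[OF that] u(1) center_one_closed by auto
    show "y = \<one>" if y: "y \<in> center G" "y \<otimes> f y = \<one>" for y
    proof -
      have yG: "y \<in> carrier G" using y(1) by (rule centerD(1))
      have "f y = \<one>"
        using f_one[OF yG] r_one[OF yG] M(2) y(1) by blast
      then show ?thesis using y(2) yG by simp
    qed
  qed (rule x(1))
  then show ?thesis
    using f_x[OF x(1)] by simp
qed

abbreviation "fourth x \<equiv> (x \<otimes> x) \<otimes> (x \<otimes> x)"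

text \<open>Squaring is multiplicative up to a commutator, and a second squaring removes that
  commutator.\<close>

lemma fourth_hom: "(\<lambda>x. fourth x) \<in> hom G G"
proof (rule homI)
  fix x y assume xy: "x \<in> carrier G" "y \<in> carrier G"
  let ?a = "x \<otimes> x" and ?b = "y \<otimes> y" and ?c = "commutator G y x"
  have a: "?a \<in> center G" "?b \<in> center G" "?c \<in> center G" "?a \<in> carrier G" "?b \<in> carrier G" "?c \<in> carrier G"
    using xy square_central commutator_central by auto
  have "fourth (x \<otimes> y) = (?a \<otimes> ?b \<otimes> ?c) \<otimes> (?a \<otimes> ?b \<otimes> ?c)"
    by (simp only: square_mult[OF xy])
  also have "\<dots> = ?a \<otimes> ?b \<otimes> (?c \<otimes> (?a \<otimes> ?b)) \<otimes> ?c"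
    using a by (simp add: m_assoc)
  also have "?c \<otimes> (?a \<otimes> ?b) = ?a \<otimes> ?b \<otimes> ?c"
    using a by (intro centerD(2)) auto
  also have "?a \<otimes> ?b \<otimes> (?a \<otimes> ?b \<otimes> ?c) \<otimes> ?c = ?a \<otimes> (?b \<otimes> ?a) \<otimes> ?b \<otimes> (?c \<otimes> ?c)"
    using a by (simp add: m_assoc)
  also have "?b \<otimes> ?a = ?a \<otimes> ?b"
    using a by (intro centerD(2)) auto
  also have "?c \<otimes> ?c = \<one>"
    using xy by (intro commutator_square)
  finally show "fourth (x \<otimes> y) = fourth x \<otimes> fourth y"
    using a by (simp add: m_assoc)
qed simp

text \<open>For f(x) = x^4 the injectivity condition concerns z f(z) = z^5, and 5 is prime to
  64.\<close>

lemma fourth_commutator: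
  assumes x: "x \<in> carrier G"
  shows "\<exists>g\<in>carrier G. fourth x = commutator G x g"
proof (rule hom_values_commutators[OF aut_eq fin fourth_hom])
  show "fourth y \<in> center G" if "y \<in> carrier G" for y
    using center_mult_closed[OF square_central[OF that] square_central[OF that]] .
  show "z = \<one>" if z: "z \<in> center G" "z \<otimes> fourth z = \<one>" for z
  proof -
    have zG: "z \<in> carrier G" using z(1) by (rule centerD(1))
    have "z [^] (5::nat) = \<one>"
      using z(2) zG by (simp add: numeral_eq_Suc m_assoc)
    then have "ord z dvd 5"
      using zG by (simp add: pow_eq_id)
    moreover have "ord z dvd 64"
      using ord_dvd_group_order[OF zG] order_64 by simp
    ultimately have "ord z dvd gcd 5 64"
      by (rule gcd_greatest)
    also have "gcd 5 64 = (1::nat)"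
      by code_simp
    finally have "z [^] (1::nat) = \<one>"
      using zG by (simp only: pow_eq_id)
    then show ?thesis using zG by simp
  qed
qed (rule x)

lemma center_fourth: "z \<in> center G \<Longrightarrow> fourth z = \<one>"
  using fourth_commutator[of z] centerD(1) commutator_center(1) by metis

lemma center_involutions_subgroup: "subgroup {z \<in> center G. z \<otimes> z = \<one>} G"
proof (rule subgroupI)
  show "{z \<in> center G. z \<otimes> z = \<one>} \<subseteq> carrier G" "{z \<in> center G. z \<otimes> z = \<one>} \<noteq> {}"
    using centerD(1) center_one_closed by auto
next
  fix a assume "a \<in> {z \<in> center G. z \<otimes> z = \<one>}"
  then have a: "a \<in> center G" "a \<otimes> a = \<one>" "a \<in> carrier G" using centerD(1) by auto
  then have "inv a = a" by (intro inv_equality) auto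
  then show "inv a \<in> {z \<in> center G. z \<otimes> z = \<one>}" using a by simp
next
  fix a b assume "a \<in> {z \<in> center G. z \<otimes> z = \<one>}" "b \<in> {z \<in> center G. z \<otimes> z = \<one>}"
  then have ab: "a \<in> center G" "a \<otimes> a = \<one>" "a \<in> carrier G" "b \<in> center G" "b \<otimes> b = \<one>" "b \<in> carrier G"
    using centerD(1) by auto
  then have "(a \<otimes> b) \<otimes> (a \<otimes> b) = \<one>"
    using square_mult[of a b] commutator_center[of b a] by simp
  then show "a \<otimes> b \<in> {z \<in> center G. z \<otimes> z = \<one>}"
    using ab center_mult_closed by simp
qed

text \<open>
  If \<open>w\<close> is central of order 4, a subgroup \<open>N\<close> containing the central involutions and maximal with
  \<open>w \<notin> N\<close> has a cyclic quotient of order 2 or 4 with unique involution \<open>w N\<close>. Mapping a generator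
  to \<open>w\<^sup>2\<close> or \<open>w\<close> gives a homomorphism into the centre with \<open>w \<mapsto> w\<^sup>2\<close>, hence a central
  automorphism that moves \<open>w\<close>.
\<close>

lemma center_elementary:
  assumes w: "w \<in> center G"
  shows "w \<otimes> w = \<one>"
proof (rule ccontr)
  assume ww: "w \<otimes> w \<noteq> \<one>"
  let ?U = "{z \<in> center G. z \<otimes> z = \<one>}"
  have wG: "w \<in> carrier G" using w by (rule centerD(1))
  have w4: "(w \<otimes> w) \<otimes> (w \<otimes> w) = \<one>" using w by (rule center_fourth)
  have "w \<notin> ?U" using ww by simp
  then obtain N where N: "subgroup N G" "?U \<subseteq> N" "w \<notin> N"
    and max: "\<And>M. \<lbrakk>subgroup M G; N \<subset> M\<rbrakk> \<Longrightarrow> w \<in> M"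
    using maximal_subgroup_avoiding[OF fin center_involutions_subgroup] by blast
  have comm_U: "commutator G x y \<in> ?U" if "x \<in> carrier G" "y \<in> carrier G" for x y
    using that commutator_central commutator_square by simp
  have normal: "N \<lhd> G"
    using N(1,2) comm_U by (intro normal_if_commutators) auto
  define r where "r v = N #> v" for v
  define K where "K = G Mod N"
  interpret r: group_hom G K r
    using quotient_map(2)[OF normal] by (simp add: r_def[abs_def] K_def)
  have r_one: "r v = \<one>\<^bsub>K\<^esub> \<longleftrightarrow> v \<in> N" if "v \<in> carrier G" for v
    using quotient_map(3)[OF normal that] by (simp add: r_def K_def)
  have r_comm: "r x \<otimes>\<^bsub>K\<^esub> r y = r y \<otimes>\<^bsub>K\<^esub> r x" if xy: "x \<in> carrier G" "y \<in> carrier G" for x y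
  proof -
    have "r (commutator G x y) = \<one>\<^bsub>K\<^esub>"
      using r_one comm_U[OF xy] N(2) xy by blast
    then have "r (y \<otimes> x \<otimes> commutator G x y) = r y \<otimes>\<^bsub>K\<^esub> r x"
      using xy by simp
    then show ?thesis
      using xy by (simp flip: swap_commutator)
  qed
  have rw: "r w \<otimes>\<^bsub>K\<^esub> r w = \<one>\<^bsub>K\<^esub>" "r w \<noteq> \<one>\<^bsub>K\<^esub>"
  proof -
    have "w \<otimes> w \<in> N" using N(2) w w4 center_mult_closed[OF w w] by blast
    then show "r w \<otimes>\<^bsub>K\<^esub> r w = \<one>\<^bsub>K\<^esub>" using r_one[of "w \<otimes> w"] wG by simp
    show "r w \<noteq> \<one>\<^bsub>K\<^esub>" using r_one[OF wG] N(3) by simp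
  qed
  have inv_cases: "r y = \<one>\<^bsub>K\<^esub> \<or> r y = r w" if y: "y \<in> carrier G" "r y \<otimes>\<^bsub>K\<^esub> r y = \<one>\<^bsub>K\<^esub>" for y
  proof -
    have "y \<otimes> y \<in> N" using r_one[of "y \<otimes> y"] y by simp
    then show ?thesis
      using maximal_avoiding_quotient[OF normal max wG N(3) y(1)] r_one[OF y(1)] unfolding r_def by blast
  qed
  \<comment> \<open>The fourth power of \<open>y\<close> is a commutator, hence lies in
    \<open>N\<close>; so the square of \<open>r y\<close> is the identity or the only involution of
    the quotient.\<close>
  have sq_cases: "r y \<otimes>\<^bsub>K\<^esub> r y = \<one>\<^bsub>K\<^esub> \<or> r y \<otimes>\<^bsub>K\<^esub> r y = r w" if y: "y \<in> carrier G" for y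
  proof -
    obtain h where h: "h \<in> carrier G" "fourth y = commutator G y h"
      using fourth_commutator[OF y] by blast
    then have "fourth y \<in> N" using comm_U[OF y h(1)] N(2) by auto
    then have "r (fourth y) = \<one>\<^bsub>K\<^esub>" using r_one[of "fourth y"] y by blast
    then show ?thesis using inv_cases[of "y \<otimes> y"] y by simp
  qed
  obtain f where f: "f \<in> hom G G" "f w = w \<otimes> w" "\<And>y. y \<in> carrier G \<Longrightarrow> \<exists>k::int. f y = w [^] k"
  proof (cases "\<forall>y\<in>carrier G. r y \<otimes>\<^bsub>K\<^esub> r y = \<one>\<^bsub>K\<^esub>")
    case True
    have cyc: "\<forall>y\<in>carrier G. \<exists>k::int. r y = r w [^]\<^bsub>K\<^esub> k"
      using inv_cases True wG r.H.int_pow_1 by (metis r.hom_closed int_pow_0)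
    have wwk: "\<forall>k::int. r w [^]\<^bsub>K\<^esub> k = \<one>\<^bsub>K\<^esub> \<longrightarrow> (w \<otimes> w) [^] k = \<one>"
      using r.H.even_if_int_pow[OF _ rw] int_pow_even[OF _ w4] wG by simp
    obtain f where f: "f \<in> hom G G"
      and f_eq: "\<And>(k::int) y. \<lbrakk>y \<in> carrier G; r y = r w [^]\<^bsub>K\<^esub> k\<rbrakk> \<Longrightarrow> f y = (w \<otimes> w) [^] k"
      using hom_of_cyclic_quotient[OF r.group_hom_axioms wG m_closed[OF wG wG] cyc wwk] by blast
    have fw: "f w = w \<otimes> w"
      using f_eq[of w 1] wG by simp
    have img: "\<exists>k::int. f y = w [^] k" if y: "y \<in> carrier G" for y
    proof -
      obtain k :: int where k: "r y = r w [^]\<^bsub>K\<^esub> k"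
        using bspec[OF cyc y] by (elim exE)
      have "f y = (w \<otimes> w) [^] k"
        by (rule f_eq[OF y k])
      also have "\<dots> = w [^] k \<otimes> w [^] k"
        by (rule int_pow_mult_distrib[OF HOL.refl wG wG])
      also have "\<dots> = w [^] (k + k)"
        by (rule int_pow_mult[OF wG, symmetric])
      finally show ?thesis by blast
    qed
    show ?thesis by (rule that[OF f fw img])
  next
    case False
    then obtain g where g: "g \<in> carrier G" "r g \<otimes>\<^bsub>K\<^esub> r g \<noteq> \<one>\<^bsub>K\<^esub>" by blast
    then have gg: "r g \<otimes>\<^bsub>K\<^esub> r g = r w" using sq_cases by blast
    have rg: "r g \<in> carrier K" using g by simp
    have pow: "r g [^]\<^bsub>K\<^esub> (2::int) = r w" "r g [^]\<^bsub>K\<^esub> (3::int) = r w \<otimes>\<^bsub>K\<^esub> r g"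
      using r.H.int_pow_2[OF rg] r.H.int_pow_mult[OF rg, of 2 1] rg by (simp_all add: gg)
    have cyc: "\<forall>y\<in>carrier G. \<exists>k::int. r y = r g [^]\<^bsub>K\<^esub> k"
    proof
      fix y assume y: "y \<in> carrier G"
      have w_case: "\<exists>k::int. r y = r g [^]\<^bsub>K\<^esub> k" if "r y = \<one>\<^bsub>K\<^esub> \<or> r y = r w"
        using that pow(1) by (metis int_pow_0)
      show "\<exists>k::int. r y = r g [^]\<^bsub>K\<^esub> k"
      proof (cases "r y \<otimes>\<^bsub>K\<^esub> r y = \<one>\<^bsub>K\<^esub>")
        case True
        then show ?thesis using inv_cases[OF y] w_case by blast
      next
        case False
        then have yy: "r y \<otimes>\<^bsub>K\<^esub> r y = r w" using sq_cases[OF y] by blast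
        have ry: "r y \<in> carrier K" using y by simp
        \<comment> \<open>In the abelian quotient both factors have square \<open>r w\<close>, so
          their product has trivial square and is 1 or \<open>r w\<close>, a power of
          \<open>r g\<close> either way.\<close>
        have "r (y \<otimes> g) \<otimes>\<^bsub>K\<^esub> r (y \<otimes> g) = r y \<otimes>\<^bsub>K\<^esub> (r g \<otimes>\<^bsub>K\<^esub> r y) \<otimes>\<^bsub>K\<^esub> r g"
          using y g ry rg by (simp add: r.H.m_assoc)
        also have "r g \<otimes>\<^bsub>K\<^esub> r y = r y \<otimes>\<^bsub>K\<^esub> r g"
          using y g by (intro r_comm)
        also have "r y \<otimes>\<^bsub>K\<^esub> (r y \<otimes>\<^bsub>K\<^esub> r g) \<otimes>\<^bsub>K\<^esub> r g = (r y \<otimes>\<^bsub>K\<^esub> r y) \<otimes>\<^bsub>K\<^esub> (r g \<otimes>\<^bsub>K\<^esub> r g)"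
          using ry rg by (simp add: r.H.m_assoc)
        also have "\<dots> = \<one>\<^bsub>K\<^esub>" by (simp add: yy gg rw)
        finally have "r (y \<otimes> g) = \<one>\<^bsub>K\<^esub> \<or> r (y \<otimes> g) = r w"
          using y g by (intro inv_cases) simp_all
        then have "r y \<otimes>\<^bsub>K\<^esub> r g = r g [^]\<^bsub>K\<^esub> (0::int) \<or> r y \<otimes>\<^bsub>K\<^esub> r g = r g [^]\<^bsub>K\<^esub> (2::int)"
          using y g by (simp add: pow)
        then obtain k :: int where "r y \<otimes>\<^bsub>K\<^esub> r g = r g [^]\<^bsub>K\<^esub> k" by blast
        then have "r y \<otimes>\<^bsub>K\<^esub> r g = r g [^]\<^bsub>K\<^esub> (k - 1) \<otimes>\<^bsub>K\<^esub> r g"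
          using rg r.H.int_pow_mult[OF rg, of "k - 1" 1] by simp
        then have "r y = r g [^]\<^bsub>K\<^esub> (k - 1)"
          using ry rg by simp
        then show ?thesis by blast
      qed
    qed
    have "r.H.ord (r g) = 4"
      using rg gg rw by (intro r.H.ord_eq_4I) simp_all
    moreover have "ord w = 4"
      using wG ww w4 by (rule ord_eq_4I)
    ultimately have wk: "\<forall>k::int. r g [^]\<^bsub>K\<^esub> k = \<one>\<^bsub>K\<^esub> \<longrightarrow> w [^] k = \<one>"
      using rg wG by (simp add: int_pow_eq_id r.H.int_pow_eq_id)
    obtain f where f: "f \<in> hom G G"
      and f_eq: "\<And>(k::int) y. \<lbrakk>y \<in> carrier G; r y = r g [^]\<^bsub>K\<^esub> k\<rbrakk> \<Longrightarrow> f y = w [^] k"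
      using hom_of_cyclic_quotient[OF r.group_hom_axioms g(1) wG cyc wk] by blast
    have fw: "f w = w \<otimes> w"
      using f_eq[of w 2] wG pow int_pow_2[OF wG] by simp
    have img: "\<exists>k::int. f y = w [^] k" if y: "y \<in> carrier G" for y
    proof -
      obtain k :: int where "r y = r g [^]\<^bsub>K\<^esub> k"
        using bspec[OF cyc y] by (elim exE)
      then show ?thesis using f_eq[OF y] by blast
    qed
    show ?thesis by (rule that[OF f fw img])
  qed
  interpret f: group_hom G G f
    using f(1) by (simp add: group_hom_def group_hom_axioms_def is_group)
  have "\<exists>g\<in>carrier G. f w = commutator G w g"
  proof (rule hom_values_commutators[OF aut_eq fin f(1)])
    show "f y \<in> center G" if "y \<in> carrier G" for y
      using f(3)[OF that] subgroup_int_pow_closed[OF center_subgroup w] by auto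
    \<comment> \<open>All values of \<open>f\<close> are powers of \<open>w\<close>, so z, the
      inverse of f(z), is one too. On powers of \<open>w\<close> the map \<open>f\<close> is
      squaring, so z^3 = 1, while z^4 = 1 holds for central z.\<close>
    show "z = \<one>" if z: "z \<in> center G" "z \<otimes> f z = \<one>" for z
    proof -
      have zG: "z \<in> carrier G" using z(1) by (rule centerD(1))
      obtain k :: int where "f z = w [^] k" using f(3)[OF zG] by blast
      then have "z = w [^] (- k)"
        using z(2) zG wG inv_equality[of z "f z"] by (simp add: int_pow_neg)
      then obtain m :: int where m: "z = w [^] m" by blast
      have "f z = (w \<otimes> w) [^] m"
        using m wG f.hom_int_pow[OF wG] f(2) by simp
      also have "\<dots> = w [^] m \<otimes> w [^] m"
        using wG by (simp add: int_pow_mult_distrib)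
      finally have fz: "f z = z \<otimes> z" by (simp add: m)
      have "z = inv (z \<otimes> f z) \<otimes> fourth z"
        using zG by (simp add: fz inv_mult_group m_assoc)
      then show ?thesis
        using z center_fourth[OF z(1)] by simp
    qed
  qed (rule wG)
  then show False
    using f(2) ww commutator_center(1)[OF w] by auto
qed

end

section \<open>A commutator of order greater than two\<close>

lemma (in class_two_group) pairing12_if_commutator_square:
  assumes order: "order G = 64" and a: "a \<in> carrier G" and b: "b \<in> carrier G"
    and cc: "commutator G a b \<otimes> commutator G a b \<noteq> \<one>"
  shows "commutator_pairing G Q12 D12 pairing12"
proof -
  define c where "c = commutator G a b"
  define n where "n = ord c"
  have fin: "finite (carrier G)"
    using order order_gt_0_iff_finite by simp
  have c: "c \<in> carrier G" "c \<in> center G"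
    using a b commutator_central by (auto simp: c_def)
  have finZ: "finite (center G)"
    using finite_subset[OF _ fin] subgroup.subset[OF center_subgroup] by blast
  have n_dvd: "n dvd 64"
    using ord_dvd_group_order[OF c(1)] order by (simp add: n_def)
  then have n0: "n > 0" by (rule dvd_pos_nat[rotated]) simp
  have c_inj: "i = j" if "c [^] i = c [^] j" "i < n" "j < n" for i j :: nat
    using inj_onD[OF ord_inj[OF c(1)] that(1)] that n0 by (auto simp: n_def)
  let ?P = "({..<n} \<times> {..<n}) \<times> center G"
  \<comment> \<open>Commuting with b and with a turns the exponents i and j into powers of c, so
    \<open>F\<close> is injective on exponents below the order of c.\<close>
  define F where "F = (\<lambda>((i, j), z). a [^] (i::nat) \<otimes> b [^] (j::nat) \<otimes> z)"
  have F_comm: "commutator G (F ((i, j), z)) b = c [^] i" "commutator G a (F ((i, j), z)) = c [^] j"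
    if "z \<in> center G" for i j z
    using that a b centerD(1)[OF that] c(1)
    by (simp_all add: F_def commutator_mult_left commutator_mult_right commutator_nat_pow_left
        commutator_nat_pow_right commutator_center flip: c_def)
  have F_inj: "inj_on F ?P"
  proof (rule inj_onI)
    fix u v assume uv: "u \<in> ?P" "v \<in> ?P" "F u = F v"
    obtain i j z i' j' z' where ijz: "u = ((i, j), z)" "v = ((i', j'), z')"
      by (metis prod.exhaust)
    have z: "z \<in> center G" "z' \<in> center G" "i < n" "i' < n" "j < n" "j' < n"
      using uv ijz by auto
    have "c [^] i = c [^] i'" "c [^] j = c [^] j'"
      using F_comm[OF z(1), of i j] F_comm[OF z(2), of i' j'] uv(3) by (simp_all add: ijz)
    then have ij: "i = i'" "j = j'"
      using c_inj z by blast+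
    have "a [^] i \<otimes> b [^] j \<otimes> z = a [^] i \<otimes> b [^] j \<otimes> z'"
      using uv(3) by (simp add: ijz ij F_def)
    then have "z = z'"
      using a b z centerD(1) by (metis l_cancel m_closed nat_pow_closed)
    then show "u = v" by (simp add: ijz ij)
  qed
  have F_sub: "F ` ?P \<subseteq> carrier G"
    using a b centerD(1) by (auto simp: F_def)
  have "card ?P \<le> 64"
    using card_mono[OF fin F_sub] card_image[OF F_inj] order by (simp add: order_def)
  then have card_le: "n * n * card (center G) \<le> 64"
    by (simp add: card_cartesian_product)
  have "inj_on (\<lambda>i. c [^] i) {..<n}"
    using c_inj by (auto intro: inj_onI)
  moreover have "(\<lambda>i. c [^] i) ` {..<n} \<subseteq> center G"
    using c subgroup_int_pow_closed[OF center_subgroup c(2)] by (auto simp flip: int_pow_int)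
  ultimately have n_le: "n \<le> card (center G)"
    using card_inj_on_le[of "\<lambda>i. c [^] i" "{..<n}" "center G"] finZ by simp
  \<comment> \<open>The powers of c already give n central elements.\<close>
  have "n * n * n \<le> 64"
    using mult_le_mono2[OF n_le, of "n * n"] card_le by linarith
  then have "n \<le> 4"
  proof (rule contrapos_pp)
    assume "\<not> n \<le> 4"
    then have "5 \<le> n" by simp
    then have "5 * 5 * 5 \<le> n * n * n" by (intro mult_le_mono)
    then show "\<not> n * n * n \<le> 64" by simp
  qed
  then have "n \<in> {1, 2, 3, 4}" using n0 by auto
  moreover have "\<not> n dvd 2"
  proof
    assume "n dvd 2"
    then have "c [^] (2::nat) = \<one>"
      using c(1) by (simp add: pow_eq_id n_def)
    then show False
      using cc c(1) by (simp add: numeral_2_eq_2 c_def)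
  qed
  ultimately have n4: "n = 4"
    using n_dvd by auto
  have "card (center G) = 4"
    using card_le n_le n4 by simp
  \<comment> \<open>With n = |Z(G)| = 4 the bound 64 is attained, so every element has the form a^i
    b^j z.\<close>
  then have "card (F ` ?P) = card (carrier G)"
    using card_image[OF F_inj] order n4 by (simp add: card_cartesian_product order_def)
  then have F_surj: "F ` ?P = carrier G"
    using card_subset_eq[OF fin F_sub] by simp
  let ?S = "{a, b} \<union> center G"
  have S: "?S \<subseteq> carrier G"
    using a b centerD(1) by auto
  have gen: "generate G ?S = carrier G"
  proof
    show "generate G ?S \<subseteq> carrier G" by (rule generate_incl[OF S])
    have sub: "subgroup (generate G ?S) G" by (rule generate_is_subgroup[OF S])
    have ab: "a \<in> generate G ?S" "b \<in> generate G ?S"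
      by (auto intro: generate.incl)
    have pow: "a [^] i \<in> generate G ?S" "b [^] i \<in> generate G ?S" for i :: nat
      using subgroup_int_pow_closed[OF sub ab(1), of "int i"] subgroup_int_pow_closed[OF sub ab(2), of "int i"]
      by (simp_all add: int_pow_int)
    have "F ` ?P \<subseteq> generate G ?S"
      using pow by (auto simp: F_def intro!: generate.eng intro: generate.incl)
    then show "carrier G \<subseteq> generate G ?S" by (simp add: F_surj)
  qed
  show ?thesis
    using commutator_pairing12I[OF a b _ gen] n4 by (simp add: n_def c_def)
qed

section \<open>The order of the centre\<close>

context elementary_commutators
begin

text \<open>The map [x, -] is onto the centre, because every central element has square 1 and is
  therefore among the values found in \<open>commutator_values\<close>; its kernel is the
  centralizer.\<close>

lemma card_centralizer:
  assumes x: "x \<in> carrier G" "x \<notin> center G"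
  shows "card {y \<in> carrier G. commutator G x y = \<one>} * card (center G) = 64"
proof -
  interpret h: group_hom G G "commutator G x"
    using commutator_hom_right[OF x(1)] by (simp add: group_hom_def group_hom_axioms_def is_group)
  have "commutator G x ` carrier G = center G"
    using commutator_central[OF x(1)] commutator_values[OF x] center_elementary by blast
  then show ?thesis
    using h.card_kernel_times_image[OF fin] order_64 by (simp add: kernel_def)
qed

lemma center_finite: "finite (center G)"
  using finite_subset[OF subgroup.subset[OF center_subgroup] fin] .

text \<open>The centralizer of \<open>x\<close> contains the centre and also \<open>x\<close>, so
  |Z(G)| < 64 / |Z(G)|.\<close>

lemma card_center_less_8:
  assumes x: "x \<in> carrier G" "x \<notin> center G"
  shows "card (center G) \<in> {1, 2, 4}"
proof -
  let ?C = "{y \<in> carrier G. commutator G x y = \<one>}"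
  have "center G \<subset> ?C"
    using x centerD(1) commutator_center(2)[OF _ x(1)] commutator_self[OF x(1)] by blast
  then have less: "card (center G) < card ?C"
    using fin by (intro psubset_card_mono) auto
  have eq: "card ?C * card (center G) = 64"
    by (rule card_centralizer[OF x])
  have "card (center G) < 8"
  proof (rule ccontr)
    assume "\<not> card (center G) < 8"
    then have "9 * 8 \<le> card ?C * card (center G)"
      using less by (intro mult_le_mono) auto
    then show False using eq by simp
  qed
  moreover have "card (center G) dvd 64"
    using eq by (metis dvd_triv_right)
  moreover have "n \<in> {1, 2, 4}" if "n < 8" "n dvd 64" for n :: nat
  proof -
    have "n \<in> {0, 1, 2, 3, 4, 5, 6, 7}" using that(1) by auto
    then show ?thesis using that(2) by auto
  qed
  ultimately show ?thesis by blast
qed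

text \<open>
  If \<open>Z(G) = {1, z}\<close>, then \<open>s x = 1\<close> or \<open>-1\<close> according to \<open>x\<^sup>2 = 1\<close> or \<open>x\<^sup>2 = z\<close> is a quadratic
  form with polarisation the commutator, and its Gauss sum has square \<open>64 \<cdot> 2\<close>.
\<close>

lemma card_center_neq_2: "card (center G) \<noteq> 2"
proof
  assume card: "card (center G) = 2"
  then obtain z where Z: "center G = {\<one>, z}" "z \<noteq> \<one>"
  proof -
    obtain u v where uv: "center G = {u, v}" "u \<noteq> v"
      using card by (auto simp: card_2_iff)
    then have "u = \<one> \<or> v = \<one>" using center_one_closed by auto
    then show thesis using that[of v] that[of u] uv by (auto simp: insert_commute)
  qed
  have zG: "z \<in> carrier G" and zz: "z \<otimes> z = \<one>"
    using Z centerD(1) center_elementary by auto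
  define \<chi> :: "'a \<Rightarrow> int" where "\<chi> u = (if u = \<one> then 1 else - 1)" for u
  have \<chi>_mult: "\<chi> (u \<otimes> v) = \<chi> u * \<chi> v" if "u \<in> center G" "v \<in> center G" for u v
    using that Z zG zz by (auto simp: \<chi>_def)
  have \<chi>_sq: "\<chi> u * \<chi> u = 1" for u by (simp add: \<chi>_def)
  define s where "s x = \<chi> (x \<otimes> x)" for x
  define \<beta> where "\<beta> x h = \<chi> (commutator G x h)" for x h
  have s_mult: "s (x \<otimes> h) = s x * s h * \<beta> x h" if "x \<in> carrier G" "h \<in> carrier G" for x h
  proof -
    have "(x \<otimes> h) \<otimes> (x \<otimes> h) = (x \<otimes> x) \<otimes> (h \<otimes> h) \<otimes> commutator G x h"
      using square_mult[OF that] commutator_sym[OF that] by simp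
    then show ?thesis
      using that by (simp add: s_def \<beta>_def \<chi>_mult square_central commutator_central center_mult_closed)
  qed
  \<comment> \<open>Character orthogonality: for noncentral h some g has [h, g] nontrivial, and
    translating by g changes the sign of the sum.\<close>
  have \<beta>_sum: "(\<Sum>x\<in>carrier G. \<beta> x h) = (if h \<in> center G then 64 else 0)" if h: "h \<in> carrier G" for h
  proof (cases "h \<in> center G")
    case True
    then have "(\<Sum>x\<in>carrier G. \<beta> x h) = (\<Sum>x\<in>carrier G. 1)"
      by (intro sum.cong) (simp_all add: \<beta>_def commutator_center \<chi>_def)
    then show ?thesis
      using True order_64 by (simp add: order_def)
  next
    case False
    obtain g where g: "g \<in> carrier G" "commutator G h g \<noteq> \<one>"
      using False h by (auto simp: center_iff_commutator)
    have \<beta>g: "\<beta> g h = - 1"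
      using g commutator_sym[OF h g(1)] by (simp add: \<beta>_def \<chi>_def)
    have "(\<Sum>x\<in>carrier G. \<beta> x h) = (\<Sum>x\<in>carrier G. \<beta> (g \<otimes> x) h)"
      using g(1) by (intro sum.reindex_bij_witness[where i = "\<lambda>x. g \<otimes> x" and j = "\<lambda>x. inv g \<otimes> x"]) auto
    also have "\<dots> = (\<Sum>x\<in>carrier G. - \<beta> x h)"
    proof (rule sum.cong[OF HOL.refl])
      fix x assume x: "x \<in> carrier G"
      have "\<beta> (g \<otimes> x) h = \<beta> g h * \<beta> x h"
        using g(1) x h by (simp add: \<beta>_def commutator_mult_left \<chi>_mult commutator_central)
      then show "\<beta> (g \<otimes> x) h = - \<beta> x h" by (simp add: \<beta>g)
    qed
    finally show ?thesis
      using False by (simp add: sum_negf)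
  qed
  define T where "T = (\<Sum>x\<in>carrier G. s x)"
  have "T * T = (\<Sum>x\<in>carrier G. \<Sum>y\<in>carrier G. s x * s y)"
    by (simp add: T_def sum_product)
  \<comment> \<open>Substitute y = x h and expand s(x h); the factor s(x) then occurs squared and
    disappears.\<close>
  also have "\<dots> = (\<Sum>x\<in>carrier G. \<Sum>h\<in>carrier G. s h * \<beta> x h)"
  proof (rule sum.cong[OF HOL.refl])
    fix x assume x: "x \<in> carrier G"
    have "(\<Sum>y\<in>carrier G. s x * s y) = (\<Sum>h\<in>carrier G. s x * s (x \<otimes> h))"
      using x by (intro sum.reindex_bij_witness[where i = "\<lambda>y. x \<otimes> y" and j = "\<lambda>y. inv x \<otimes> y"]) auto
    also have "\<dots> = (\<Sum>h\<in>carrier G. s h * \<beta> x h)"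
    proof (rule sum.cong[OF HOL.refl])
      fix h assume h: "h \<in> carrier G"
      have "s x * s (x \<otimes> h) = (s x * s x) * (s h * \<beta> x h)"
        by (simp add: s_mult[OF x h])
      then show "s x * s (x \<otimes> h) = s h * \<beta> x h"
        by (simp add: s_def \<chi>_sq)
    qed
    finally show "(\<Sum>y\<in>carrier G. s x * s y) = (\<Sum>h\<in>carrier G. s h * \<beta> x h)" .
  qed
  also have "\<dots> = (\<Sum>h\<in>carrier G. \<Sum>x\<in>carrier G. s h * \<beta> x h)"
    by (rule sum.swap)
  also have "\<dots> = (\<Sum>h\<in>carrier G. if h \<in> center G then 64 else 0)"
  proof (rule sum.cong[OF HOL.refl])
    fix h assume h: "h \<in> carrier G"
    have "(\<Sum>x\<in>carrier G. s h * \<beta> x h) = s h * (\<Sum>x\<in>carrier G. \<beta> x h)"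
      by (simp add: sum_distrib_left)
    also have "\<dots> = (if h \<in> center G then 64 else 0)"
      using \<beta>_sum[OF h] center_elementary[of h] by (simp add: s_def \<chi>_def)
    finally show "(\<Sum>x\<in>carrier G. s h * \<beta> x h) = (if h \<in> center G then 64 else 0)" .
  qed
  also have "\<dots> = (\<Sum>h\<in>center G. 64)"
    using subgroup.subset[OF center_subgroup] by (intro sum.mono_neutral_cong_right fin) auto
  also have "\<dots> = 128"
    by (simp add: card)
  finally have "\<bar>T\<bar> * \<bar>T\<bar> = 128" by simp
  \<comment> \<open>128 lies strictly between the consecutive squares 121 and 144.\<close>
  moreover have "\<bar>T\<bar> * \<bar>T\<bar> \<le> 11 * 11" if "\<bar>T\<bar> \<le> 11"
    using that by (intro mult_mono) auto
  moreover have "12 * 12 \<le> \<bar>T\<bar> * \<bar>T\<bar>" if "\<not> \<bar>T\<bar> \<le> 11"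
    using that by (intro mult_mono) auto
  ultimately show False by linarith
qed

section \<open>Commuting classes when the centre has order 4\<close>

lemma centralizer_subgroup:
  assumes x: "x \<in> carrier G"
  shows "subgroup {y \<in> carrier G. commutator G x y = \<one>} G"
proof -
  interpret h: group_hom G G "commutator G x"
    using commutator_hom_right[OF x] by (simp add: group_hom_def group_hom_axioms_def is_group)
  show ?thesis
    using h.subgroup_kernel by (simp add: kernel_def)
qed

lemma coset_card:
  assumes "y \<in> carrier G"
  shows "card {v \<in> carrier G. y \<otimes> v \<in> center G} = card (center G)"
proof (rule bij_betw_same_card)
  show "bij_betw (\<lambda>v. y \<otimes> v) {v \<in> carrier G. y \<otimes> v \<in> center G} (center G)"
    using assms centerD(1) by (intro bij_betwI[where g = "\<lambda>z. inv y \<otimes> z"]) auto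
qed

text \<open>The centralizer of \<open>y\<close> has order 16. Unless y x is central, its
  intersection with the centralizer of \<open>x\<close> contains the centre, another coset of it
  (that of y^-1) and also \<open>x\<close>, hence at least 9 elements. Its order divides 64, so it
  is the whole centralizer of \<open>y\<close>.\<close>

lemma commuting_trans:
  assumes Z: "card (center G) = 4"
    and x: "x \<in> carrier G" "x \<notin> center G" and y: "y \<in> carrier G" "y \<notin> center G" and w: "w \<in> carrier G"
    and xy: "commutator G x y = \<one>" and yw: "commutator G y w = \<one>"
  shows "commutator G x w = \<one>"
proof (cases "y \<otimes> x \<in> center G")
  case True
  have "commutator G (y \<otimes> x) w = \<one>"
    by (rule commutator_center(1)[OF True w])
  then show ?thesis
    using x y w yw by (simp add: commutator_mult_left)
next
  case False
  let ?C = "{v \<in> carrier G. commutator G y v = \<one>}"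
  let ?M = "?C \<inter> {v \<in> carrier G. commutator G x v = \<one>}"
  let ?B = "{v \<in> carrier G. y \<otimes> v \<in> center G}"
  have "subgroup ?M G"
    using centralizer_subgroup x(1) y(1) by (intro subgroups_Inter_pair)
  then have "card (rcosets ?M) * card ?M = 64"
    using lagrange[of ?M] order_64 by simp
  then have "card ?M dvd 64"
    using dvd_triv_right[of "card ?M" "card (rcosets ?M)"] by simp
  moreover have card_C: "card ?C = 16"
    using card_centralizer[OF y] Z by simp
  have finC: "finite ?C" "finite ?M"
    using fin by auto
  have "9 \<le> card ?M"
  proof -
    have B: "?B \<subseteq> ?M"
    proof
      fix v assume "v \<in> ?B"
      then have v: "v \<in> carrier G" "y \<otimes> v \<in> center G" by auto
      have "commutator G y (y \<otimes> v) = \<one>" "commutator G x (y \<otimes> v) = \<one>"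
        using commutator_center(2)[OF v(2)] x y by auto
      then show "v \<in> ?M"
        using v(1) x(1) y(1) xy by (simp add: commutator_mult_right)
    qed
    have ZM: "center G \<subseteq> ?M"
      using commutator_center(2) x y centerD(1) by auto
    have "x \<in> ?M"
      using x y xy commutator_sym by auto
    then have sub: "insert x (?B \<union> center G) \<subseteq> ?M"
      using B ZM by blast
    have disj: "?B \<inter> center G = {}"
    proof (rule ccontr)
      assume "?B \<inter> center G \<noteq> {}"
      then obtain v where v: "v \<in> center G" "y \<otimes> v \<in> center G" by blast
      then have "(y \<otimes> v) \<otimes> inv v \<in> center G"
        using center_mult_closed center_inv_closed by blast
      then show False
        using y v centerD(1)[OF v(1)] by (simp add: m_assoc)
    qed
    have finB: "finite ?B" using fin by simp
    have "card (?B \<union> center G) = 8"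
      using card_Un_disjoint[OF finB center_finite disj] coset_card[OF y(1)] Z by simp
    moreover have "x \<notin> ?B \<union> center G"
      using False x by blast
    ultimately have "card (insert x (?B \<union> center G)) = 9"
      using finB center_finite by simp
    then show ?thesis
      using card_mono[OF finC(2) sub] by simp
  qed
  moreover have "card ?M \<le> 16"
    using card_mono[OF finC(1), of ?M] card_C by auto
  ultimately have "card ?M = 16"
  proof -
    have "n = 16" if "n dvd 64" "9 \<le> n" "n \<le> 16" for n :: nat
    proof -
      have "n \<in> {9, 10, 11, 12, 13, 14, 15, 16}" using that(2,3) by auto
      then show ?thesis using that(1) by auto
    qed
    then show ?thesis using \<open>card ?M dvd 64\<close> \<open>9 \<le> card ?M\<close> \<open>card ?M \<le> 16\<close> by blast
  qed
  then have "?M = ?C"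
    using card_C by (intro card_subset_eq[OF finC(1)]) auto
  then show ?thesis
    using w yw by blast
qed

lemma center_eq_4:
  assumes "card (center G) = 4" "p \<in> center G" "q \<in> center G" "p \<noteq> \<one>" "q \<noteq> \<one>" "p \<noteq> q"
  shows "center G = {\<one>, p, q, p \<otimes> q}"
proof -
  have pq: "p \<in> carrier G" "q \<in> carrier G"
    using assms centerD(1) by auto
  have "p \<otimes> q \<noteq> \<one>"
    using center_elementary[OF assms(2)] assms(6) pq by (metis l_cancel)
  moreover have "p \<otimes> q \<noteq> p" "p \<otimes> q \<noteq> q"
    using pq assms by auto
  ultimately have "card {\<one>, p, q, p \<otimes> q} = 4"
    using assms by auto
  then show ?thesis
    using assms center_one_closed center_mult_closed
    by (intro card_subset_eq[OF center_finite, symmetric]) auto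
qed

lemma pairing13_if_card_center_4:
  assumes Z: "card (center G) = 4" and "\<exists>a\<in>carrier G. a \<notin> center G"
  shows "commutator_pairing G Q13 D13 pairing13"
proof -
  obtain a where a: "a \<in> carrier G" "a \<notin> center G"
    using assms(2) by blast
  \<comment> \<open>The centralizer of \<open>x\<close> has 16 elements, and the centre together
    with the coset of x^-1 covers at most 8 of them.\<close>
  have partner: "\<exists>y\<in>carrier G. commutator G x y = \<one> \<and> y \<notin> center G \<and> x \<otimes> y \<notin> center G"
    if x: "x \<in> carrier G" "x \<notin> center G" for x
  proof (rule ccontr)
    assume "\<not> ?thesis"
    then have "{y \<in> carrier G. commutator G x y = \<one>} \<subseteq> center G \<union> {v \<in> carrier G. x \<otimes> v \<in> center G}"
      by blast
    then have "card {y \<in> carrier G. commutator G x y = \<one>} \<le> card (center G \<union> {v \<in> carrier G. x \<otimes> v \<in> center G})"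
      using fin center_finite by (intro card_mono) auto
    also have "\<dots> \<le> 8"
      using card_Un_le[of "center G" "{v \<in> carrier G. x \<otimes> v \<in> center G}"] coset_card[OF x(1)] Z by simp
    finally show False
      using card_centralizer[OF x] Z by simp
  qed
  obtain b where b: "b \<in> carrier G" "commutator G a b = \<one>" "b \<notin> center G" "a \<otimes> b \<notin> center G"
    using partner[OF a] by blast
  obtain c where c: "c \<in> carrier G" "commutator G a c \<noteq> \<one>"
    using a by (auto simp: center_iff_commutator)
  have cZ: "c \<notin> center G"
    using c commutator_center(2) a by blast
  obtain d where d: "d \<in> carrier G" "commutator G c d = \<one>" "d \<notin> center G" "c \<otimes> d \<notin> center G"
    using partner[OF c(1) cZ] by blast
  \<comment> \<open>A commuting pair would link the class of \<open>a\<close> to that of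
    \<open>c\<close> by transitivity.\<close>
  have nc: "commutator G u v \<noteq> \<one>"
    if u: "u \<in> carrier G" "u \<notin> center G" "commutator G a u = \<one>"
      and v: "v \<in> carrier G" "v \<notin> center G" "commutator G c v = \<one>" for u v
  proof
    assume "commutator G u v = \<one>"
    then have "commutator G a v = \<one>"
      using commuting_trans[OF Z a u(1,2) v(1) u(3)] by blast
    moreover have "commutator G v c = \<one>"
      using v c commutator_sym by simp
    ultimately show False
      using commuting_trans[OF Z a v(1,2) c(1)] c by blast
  qed
  define p q s t where pqst: "p = commutator G a c" "q = commutator G b c" "s = commutator G a d" "t = commutator G b d"
  have abcdG: "a \<otimes> b \<in> carrier G" "c \<otimes> d \<in> carrier G" using a b c d by auto
  have comms: "commutator G a (a \<otimes> b) = \<one>" "commutator G c (c \<otimes> d) = \<one>"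
    using a b c d by (simp_all add: commutator_mult_right)
  have central: "p \<in> center G" "q \<in> center G" "s \<in> center G" "t \<in> center G"
    using a b c d commutator_central by (simp_all add: pqst)
  then have carr: "p \<in> carrier G" "q \<in> carrier G" "s \<in> carrier G" "t \<in> carrier G"
    using centerD(1) by blast+
  have sq: "p \<otimes> p = \<one>" "q \<otimes> q = \<one>"
    using central center_elementary by auto
  have neq: "p \<noteq> \<one>" "q \<noteq> \<one>" "s \<noteq> \<one>" "t \<noteq> \<one>"
    using a b c d cZ by (simp_all add: pqst nc)
  \<comment> \<open>These products are [a b, c], [a b, d], [a, c d] and [b, c d]; the product in
    \<open>neq3\<close> is [a b, c d].\<close>
  have neq2: "p \<otimes> q \<noteq> \<one>" "s \<otimes> t \<noteq> \<one>" "p \<otimes> s \<noteq> \<one>" "q \<otimes> t \<noteq> \<one>"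
    using nc[OF abcdG(1) b(4) comms(1) c(1) cZ] nc[OF abcdG(1) b(4) comms(1) d(1,3,2)]
      nc[OF a _ abcdG(2) d(4) comms(2)] nc[OF b(1,3,2) abcdG(2) d(4) comms(2)] a b c d
    by (simp_all add: pqst commutator_mult_left commutator_mult_right)
  have neq3: "(p \<otimes> s) \<otimes> (q \<otimes> t) \<noteq> \<one>"
    using nc[OF abcdG(1) b(4) comms(1) abcdG(2) d(4) comms(2)] a b c d commutator_mult_left[OF abcdG(2) a(1) b(1)]
    by (simp add: pqst commutator_mult_right)
  have pq: "p \<noteq> q"
    using neq2(1) sq by auto
  note Z4 = center_eq_4[OF Z central(1,2) neq(1,2) pq]
  have pq_comm: "q \<otimes> p = p \<otimes> q"
    using centerD(2)[OF central(2) carr(1)] .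
  have s: "s = q \<or> s = p \<otimes> q"
    using central(3) Z4 neq neq2 sq by auto
  have t: "t = p \<or> t = p \<otimes> q"
    using central(4) Z4 neq neq2 sq by auto
  \<comment> \<open>Of the four combinations left for (s, t), (q, p) contradicts \<open>neq3\<close>
    and (p q, p q) contradicts s t \<noteq> 1. For (q, p q) take e = d. For (p q, p) take e = c d,
    since [a, c d] = p p q = q and [b, c d] = q p.\<close>
  have "\<exists>e\<in>carrier G. commutator G c e = \<one> \<and> commutator G a e = q \<and> commutator G b e = p \<otimes> q"
    using s
  proof
    assume sq': "s = q"
    have "t \<noteq> p"
    proof
      assume "t = p"
      then have "(p \<otimes> s) \<otimes> (q \<otimes> t) = (p \<otimes> q) \<otimes> (p \<otimes> q)"
        by (simp add: sq' pq_comm)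
      then show False
        using neq3 center_elementary[OF center_mult_closed[OF central(1,2)]] by simp
    qed
    then show ?thesis
      using t d sq' by (auto simp: pqst)
  next
    assume spq: "s = p \<otimes> q"
    have "t \<noteq> p \<otimes> q"
      using neq2(2) center_elementary[OF center_mult_closed[OF central(1,2)]] by (auto simp: spq)
    then have "t = p" using t by blast
    then have "commutator G a (c \<otimes> d) = q" "commutator G b (c \<otimes> d) = p \<otimes> q"
      using a b c d spq carr pq_comm sq by (simp_all add: commutator_mult_right flip: pqst m_assoc)
    then show ?thesis
      using abcdG(2) comms(2) by blast
  qed
  then obtain e where e: "e \<in> carrier G" "commutator G c e = \<one>" "commutator G a e = q" "commutator G b e = p \<otimes> q"
    by blast
  let ?S = "{a, b, c, e} \<union> center G"
  have S: "?S \<subseteq> carrier G"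
    using a b c e centerD(1) by auto
  have gen: "generate G ?S = carrier G"
  proof
    show "generate G ?S \<subseteq> carrier G" by (rule generate_incl[OF S])
    \<comment> \<open>Multiply \<open>x\<close> by some u among 1, a, b, a b to make it commute with
      \<open>c\<close>, then by some v among 1, c, e, c e, which preserves this, to make it commute
      with \<open>a\<close>. Multiplying works as well as dividing because commutators are their own
      inverses. The result is central, since otherwise transitivity would give [a, c] = 1.\<close>
    show "carrier G \<subseteq> generate G ?S"
    proof
      fix x assume x: "x \<in> carrier G"
      let ?K = "generate G ?S"
      have K: "subgroup ?K G" by (rule generate_is_subgroup[OF S])
      have in_K: "\<one> \<in> ?K" "a \<in> ?K" "b \<in> ?K" "c \<in> ?K" "e \<in> ?K" "a \<otimes> b \<in> ?K" "c \<otimes> e \<in> ?K"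
        by (auto intro: generate.incl generate.one generate.eng)
      have val_u: "commutator G \<one> c = \<one>" "commutator G b c = q" "commutator G (a \<otimes> b) c = p \<otimes> q" "commutator G a c = p"
        using a b c by (simp_all add: commutator_center center_one_closed commutator_mult_left pqst)
      have val_v: "commutator G a \<one> = \<one>" "commutator G a c = p" "commutator G a e = q" "commutator G a (c \<otimes> e) = p \<otimes> q"
        using a c e by (simp_all add: commutator_center center_one_closed commutator_mult_right pqst)
      have center_cases: "w = \<one> \<or> w = p \<or> w = q \<or> w = p \<otimes> q" if "w \<in> center G" for w
        using that Z4 by simp
      have "\<exists>u\<in>?K. commutator G u c = w" if "w \<in> center G" for w
        using center_cases[OF that] val_u in_K by metis
      then obtain u where u: "u \<in> ?K" "commutator G u c = commutator G x c"
        using commutator_central[OF x c(1)] by metis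
      have uG: "u \<in> carrier G" using u(1) K subgroup.mem_carrier by metis
      have xu: "x \<otimes> u \<in> carrier G" "commutator G (x \<otimes> u) c = \<one>"
        using x uG c u(2) by (simp_all add: commutator_mult_left commutator_square)
      have v_comm: "commutator G \<one> c = \<one>" "commutator G c c = \<one>" "commutator G e c = \<one>" "commutator G (c \<otimes> e) c = \<one>"
        using c e commutator_sym[OF c(1) e(1)] by (simp_all add: commutator_center center_one_closed commutator_mult_left)
      have "\<exists>v\<in>?K. commutator G a v = w \<and> commutator G v c = \<one>" if "w \<in> center G" for w
        using center_cases[OF that] val_v v_comm in_K by metis
      then obtain v where v: "v \<in> ?K" "commutator G a v = commutator G a (x \<otimes> u)" "commutator G v c = \<one>"
        using commutator_central[OF a(1) xu(1)] by metis
      have vG: "v \<in> carrier G" using v(1) K subgroup.mem_carrier by metis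
      let ?y = "x \<otimes> u \<otimes> v"
      have y: "?y \<in> carrier G" "commutator G ?y c = \<one>" "commutator G a ?y = \<one>"
      proof -
        show "?y \<in> carrier G" using xu vG by simp
        show "commutator G ?y c = \<one>"
          using commutator_mult_left[OF c(1) xu(1) vG] xu(2) v(3) by simp
        show "commutator G a ?y = \<one>"
          using commutator_mult_right[OF a(1) xu(1) vG] v(2) commutator_square[OF a(1) xu(1)] by simp
      qed
      have "?y \<in> center G"
        using commuting_trans[OF Z a y(1) _ c(1) y(3,2)] c(2) by blast
      then have "?y \<in> ?K" by (auto intro: generate.incl)
      then have "?y \<otimes> inv v \<otimes> inv u \<in> ?K"
        using u(1) v(1) subgroup.m_closed[OF K] subgroup.m_inv_closed[OF K] by blast
      then show "x \<in> ?K"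
        using x uG vG by (simp add: m_assoc)
    qed
  qed
  show ?thesis
    by (rule commutator_pairing13I[OF a(1) b(1) c(1) e(1) b(2) e(2) pqst(1)[symmetric] e(3) pqst(2)[symmetric] e(4)
          neq(1,2) pq sq gen])
qed

end

theorem theorem5p6:
  fixes G :: "('a, 'm) monoid_scheme"
  assumes "group G" and "\<not> comm_group G" and "order G = 2 ^ 6"
  shows "class_preserving_auts G = central_auts G \<longleftrightarrow> in_Phi12 G \<or> in_Phi13 G"
proof
  interpret group G by (rule assms(1))
  show "class_preserving_auts G = central_auts G" if "in_Phi12 G \<or> in_Phi13 G"
    using that by (rule class_preserving_eq_central_if_Phi)
  assume eq: "class_preserving_auts G = central_auts G"
  have order: "order G = 64" using assms(3) by simp
  have "class_two_group G"
    using eq by (intro class_two_if_class_preserving_central) simp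
  then interpret class_two_group G .
  show "in_Phi12 G \<or> in_Phi13 G"
  proof (cases "\<exists>a\<in>carrier G. \<exists>b\<in>carrier G. commutator G a b \<otimes>\<^bsub>G\<^esub> commutator G a b \<noteq> \<one>\<^bsub>G\<^esub>")
    case True
    then have "commutator_pairing G Q12 D12 pairing12"
      using pairing12_if_commutator_square[OF order] by blast
    then have "isoclinic G (presented_group Phi12_rels)"
      using Q12_group Phi12_presented_group
      by (intro isoclinic_if_same_pairing[OF is_group group_presented_group]) (auto simp: comm_group_def)
    then show ?thesis
      using order is_group by (simp add: in_Phi12_def)
  next
    case False
    then have "elementary_commutators G"
      using eq order class_two_group_axioms
      by (intro elementary_commutators.intro elementary_commutators_axioms.intro) auto
    then interpret elementary_commutators G .
    obtain a b where ab: "a \<in> carrier G" "b \<in> carrier G" "a \<otimes>\<^bsub>G\<^esub> b \<noteq> b \<otimes>\<^bsub>G\<^esub> a"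
      using assms(2) group_comm_groupI by blast
    then have aZ: "a \<notin> center G"
      using centerD(2) by blast
    have "card (center G) \<noteq> 1"
    proof
      assume "card (center G) = 1"
      then have "center G = {\<one>\<^bsub>G\<^esub>}"
        using center_one_closed by (auto simp: card_1_singleton_iff)
      then have "commutator G a b = \<one>\<^bsub>G\<^esub>"
        using commutator_central[OF ab(1,2)] by simp
      then show False
        using ab by (simp add: commutator_eq_one_iff)
    qed
    then have "card (center G) = 4"
      using card_center_less_8[OF ab(1) aZ] card_center_neq_2 by simp
    then have "commutator_pairing G Q13 D13 pairing13"
      using pairing13_if_card_center_4 ab(1) aZ by blast
    then have "isoclinic G (presented_group Phi13_rels)"
      using Q13_group D13_group Phi13_presented_group
      by (intro isoclinic_if_same_pairing[OF is_group group_presented_group]) (auto simp: comm_group_def)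
    then show ?thesis
      using order is_group by (simp add: in_Phi13_def)
  qed
qed

end
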